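(* Consider the four-node network with the setting described in the context. Under joint network and channel decoding at node 4, the achievable rate region $\Lambda_{\text{joint}}$ is the convex hull of all rate pairs $(R_A,R_B)$ satisfying $$R_A \le \mathbb{C}_{1,4}+\mathbb{C}'-\mathbb{C}'', \qquad R_B \le \mathbb{C}', \qquad R_A+R_B \le \mathbb{C}_{1,4}+\mathbb{C}',$$ where $\mathbb{C}_{1,4}=1-H(p_{1,4})$, $\mathbb{C}'=1-H(p')$ and $\mathbb{C}''=1-H(p'')$ with $$p' = [(1-p_{1,3})(1-p_{2,3})+p_{1,3}p_{2,3}]\,p_{3,4} + [p_{1,3}(1-p_{2,3})+(1-p_{1,3})p_{2,3}](1-p_{3,4}),$$ $$p'' = p_{1,3}(1-p_{2,3})(1-p_{3,4})(1-p_{1,4}) + (1-p_{1,3})p_{2,3}(1-p_{3,4})(1-p_{1,4}) + (1-p_{1,3})(1-p_{2,3})p_{3,4}(1-p_{1,4}) + (1-p_{1,3})(1-p_{2,3})(1-p_{3,4})p_{1,4} + (1-p_{1,3})p_{2,3}p_{3,4}p_{1,4} + p_{1,3}(1-p_{2,3})p_{3,4}p_{1,4} + p_{1,3}p_{2,3}(1-p_{3,4})p_{1,4} + p_{1,3}p_{2,3}p_{3,4}(1-p_{1,4}).$$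
   Context: Network: nodes $1,2,3,4$ with directed links $1\to3$, $1\to4$, $2\to3$, $3\to4$. Each link $i\to j$ is a binary symmetric channel (BSC) with crossover probability $p_{i,j}$: input $X_{i,j}\in\{0,1\}$, output $Y_{i,j}=X_{i,j}\oplus E_{i,j}$ with $\Pr\{E_{i,j}=1\}=p_{i,j}$; the link channels are independent, time invariant and memoryless. $H(p)=-p\log p-(1-p)\log(1-p)$ is the binary entropy function (base 2), and the capacity of a BSC with crossover $p$ is $1-H(p)$. Messages $A$ and $B$ are independent and uniformly distributed on $\{1,\dots,\lfloor 2^{nR_A}\rfloor\}$ and $\{1,\dots,\lfloor 2^{nR_B}\rfloor\}$, with $n$ the common block length (each link is used $n$ times). Node 1 encodes $A$ with a channel code into $\mathbf{X}_{1,3}(A)=\mathbf{X}_{1,4}(A)\in\{0,1\}^n$ and sends it on both links $1\to3$ and $1\to4$; node 2 encodes $B$ with a channel code into $\mathbf{X}_{2,3}(B)\in\{0,1\}^n$ and sends it on link $2\to3$. Node 3 performs no decoding: it transmits $\mathbf{X}_{3,4}=\mathbf{Y}_{1,3}\oplus\mathbf{Y}_{2,3}$ (bitwise XOR). Node 4 must estimate $(\hat A,\hat B)$ from $\mathbf{Y}_{1,4}$ and $\mathbf{Y}_{3,4}$; a rate pair is achievable if $\Pr\{(\hat A,\hat B)\neq(A,B)\}$ can be made arbitrarily small. Joint decoding: node 4 decodes $(A,B)$ jointly from the pair $(\mathbf{Y}_{1,4},\mathbf{Y}_{3,4})$. The achievable rate region of a strategy is the set of rate pairs achievable when node 4 uses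 that strategy.
   Formalization: The achievable rate region is taken as the closure of the set of achievable nonnegative rate pairs, since pairs on the boundary (rates exactly at capacity) are in general not themselves achievable; achievable means the error probability tends to zero as the block length grows. *)

theory Defs
  imports "HOL-Analysis.Analysis"
begin

(* binary entropy function, base 2 (note: log 2 0 = 0 in Isabelle, so 0 log 0 = 0) *)
definition Hb :: "real \<Rightarrow> real" where
  "Hb p = - p * log 2 p - (1 - p) * log 2 (1 - p)"

definition bsc_cap :: "real \<Rightarrow> real" where
  "bsc_cap p = 1 - Hb p"

definition words :: "nat \<Rightarrow> bool list set" where
  "words n = {xs. length xs = n}"

definition bxor :: "bool list \<Rightarrow> bool list \<Rightarrow> bool list" where
  "bxor xs ys = map2 (\<noteq>) xs ys"

definition err_prob :: "real \<Rightarrow> bool list \<Rightarrow> real" where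
  "err_prob p e = prod_list (map (\<lambda>b. if b then p else 1 - p) e)"

definition num_msgs :: "nat \<Rightarrow> real \<Rightarrow> nat" where
  "num_msgs n R = nat \<lfloor>2 powr (real n * R)\<rfloor>"

(* Average error probability of the scheme: node 1 sends f A on links 1->3 and 1->4,
   node 2 sends g B on 2->3, node 3 forwards Y13 xor Y23 on 3->4,
   node 4 decodes (A,B) jointly from (Y14, Y34) with decoder d. *)
definition joint_err ::
  "real \<Rightarrow> real \<Rightarrow> real \<Rightarrow> real \<Rightarrow> nat \<Rightarrow> nat \<Rightarrow> nat \<Rightarrow>
   (nat \<Rightarrow> bool list) \<Rightarrow> (nat \<Rightarrow> bool list) \<Rightarrow> (bool list \<Rightarrow> bool list \<Rightarrow> nat \<times> nat) \<Rightarrow> real" where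
  "joint_err p13 p14 p23 p34 n MA MB f g d =
     (1 / (real MA * real MB)) *
     (\<Sum>a\<in>{1..MA}. \<Sum>b\<in>{1..MB}.
        \<Sum>e13\<in>words n. \<Sum>e14\<in>words n. \<Sum>e23\<in>words n. \<Sum>e34\<in>words n.
          err_prob p13 e13 * err_prob p14 e14 * err_prob p23 e23 * err_prob p34 e34 *
          (let y14 = bxor (f a) e14;
               y34 = bxor (bxor (bxor (f a) e13) (bxor (g b) e23)) e34
           in if d y14 y34 \<noteq> (a, b) then 1 else 0))"

definition joint_achievable :: "real \<Rightarrow> real \<Rightarrow> real \<Rightarrow> real \<Rightarrow> real \<times> real \<Rightarrow> bool" where
  "joint_achievable p13 p14 p23 p34 R \<longleftrightarrow>
     0 \<le> fst R \<and> 0 \<le> snd R \<and>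
     (\<forall>\<epsilon>>0. \<exists>N. \<forall>n\<ge>N. \<exists>f g d.
        (\<forall>a\<in>{1..num_msgs n (fst R)}. length (f a) = n) \<and>
        (\<forall>b\<in>{1..num_msgs n (snd R)}. length (g b) = n) \<and>
        joint_err p13 p14 p23 p34 n (num_msgs n (fst R)) (num_msgs n (snd R)) f g d \<le> \<epsilon>)"

definition Lambda_joint :: "real \<Rightarrow> real \<Rightarrow> real \<Rightarrow> real \<Rightarrow> (real \<times> real) set" where
  "Lambda_joint p13 p14 p23 p34 = closure {R. joint_achievable p13 p14 p23 p34 R}"

end

theory Submission
  imports Defs
begin

text \<open>Node 4 observes \<open>U = f A + E\<close> and \<open>V = f A + g B + E'\<close>, where \<open>E\<close> and \<open>E'\<close>
  are independent Bernoulli noise words of parameters \<open>p14\<close> and \<open>p'\<close>, and \<open>U + V + g B = E + E'\<close> has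
  parameter \<open>p''\<close>. By Chebyshev's inequality \<open>E\<close>, \<open>E'\<close> and \<open>E + E'\<close> are typical with high probability.
  For the converse, a code can only be correct on as many typical noise words as there are received
  words. For achievability, choose both codebooks at random and decode to a pair for which all three
  noise words are typical; the three inequalities of the region make the expected number of wrong
  pairs vanish in which only the first, only the second, or both messages are wrong. The region is
  closed and convex, and shrinking a point towards the origin makes its nonzero rates satisfy the
  inequalities strictly.\<close>

text \<open>The first inequality stems from the shared codeword. Once \<open>B\<close> is known, the
  two observations are equivalent to \<open>U\<close> together with \<open>E + E'\<close>, and the
  latter does not involve \<open>f A\<close>. There are about 2^n values of the former and 2^(n Hb
  p'') of the latter, to be shared among about 2^(n (Hb p14 + Hb p')) noise pairs for each value of
  \<open>A\<close>. This leaves the exponent 1 + Hb p'' - Hb p14 - Hb p', which is the capacity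
  expression bounding \<open>RA\<close>. The converse argues by such counts instead of mutual
  information and uses only that the error is eventually at most 1/4. The deleted simp rules would
  turn sums of indicators into sums over intersections or cardinalities; as factors, indicators can
  be moved across sums.\<close>

declare sum_of_bool_mult_eq [simp del] sum_mult_of_bool_eq [simp del] sum_of_bool_eq [simp del]

section \<open>Binary words\<close>

lemma bxor_commute: "bxor xs ys = bxor ys xs"
  unfolding bxor_def by (induction xs ys rule: list_induct2') auto

lemma bxor_assoc: "bxor (bxor xs ys) zs = bxor xs (bxor ys zs)"
proof (induction xs arbitrary: ys zs)
  case (Cons x xs)
  then show ?case by (cases ys; cases zs) (auto simp: bxor_def)
qed (simp add: bxor_def)

lemma bxor_left_commute: "bxor xs (bxor ys zs) = bxor ys (bxor xs zs)"
  by (metis bxor_assoc bxor_commute)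

lemmas bxor_ac = bxor_assoc bxor_commute bxor_left_commute

lemma bxor_cancel_left: "length x = length y \<Longrightarrow> bxor x (bxor x y) = y"
  unfolding bxor_def by (induction x y rule: list_induct2) auto

lemma bxor_in_words: "x \<in> words n \<Longrightarrow> y \<in> words n \<Longrightarrow> bxor x y \<in> words n"
  by (simp add: words_def bxor_def)

lemma bxor_words_cancel: "x \<in> words n \<Longrightarrow> y \<in> words n \<Longrightarrow> bxor x (bxor x y) = y"
  by (simp add: words_def bxor_cancel_left)

lemma finite_words [simp]: "finite (words n)"
  using finite_lists_length_eq[of "UNIV :: bool set" n] by (simp add: words_def)

lemma card_words: "card (words n) = 2 ^ n"
  using card_lists_length_eq[of "UNIV :: bool set" n] by (simp add: words_def)

lemma words_0: "words 0 = {[]}"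
  by (auto simp: words_def)

lemma sum_words_Suc:
  "(\<Sum>e\<in>words (Suc n). F e) = (\<Sum>e\<in>words n. F (True # e)) + (\<Sum>e\<in>words n. F (False # e))"
proof -
  have "words (Suc n) = (#) True ` words n \<union> (#) False ` words n"
    by (auto simp: words_def length_Suc_conv image_iff)
  moreover have "(#) True ` words n \<inter> (#) False ` words n = {}"
    by auto
  ultimately show ?thesis
    by (simp add: sum.union_disjoint sum.reindex)
qed

lemma sum_words_bxor:
  assumes "x \<in> words n"
  shows "(\<Sum>e\<in>words n. F (bxor x e)) = (\<Sum>e\<in>words n. F e)"
  by (rule sum.reindex_bij_witness[where i = "bxor x" and j = "bxor x"])
     (use assms in \<open>auto simp: bxor_in_words bxor_words_cancel\<close>)

section \<open>Noise distributions\<close>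

lemma err_prob_simps [simp]:
  "err_prob p [] = 1" "err_prob p (b # e) = (if b then p else 1 - p) * err_prob p e"
  by (simp_all add: err_prob_def)

lemma err_prob_nonneg: "0 \<le> p \<Longrightarrow> p \<le> 1 \<Longrightarrow> 0 \<le> err_prob p e"
  by (induction e) auto

lemma sum_err_prob: "(\<Sum>e\<in>words n. err_prob p e) = 1"
proof (induction n)
  case (Suc n)
  then show ?case
    by (simp add: sum_words_Suc sum_distrib_left[symmetric])
qed (simp add: words_0)

text \<open>Crossover probability of two binary symmetric channels in cascade: the XOR of
  independent Bernoulli bits with parameters \<open>p\<close> and \<open>q\<close> is 1 with this
  probability.\<close>

definition bsc_compose :: "real \<Rightarrow> real \<Rightarrow> real" where
  "bsc_compose p q = p * (1 - q) + (1 - p) * q"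

lemma bsc_compose_bounds:
  assumes "0 \<le> p" "p \<le> 1" "0 \<le> q" "q \<le> 1"
  shows "0 \<le> bsc_compose p q" "bsc_compose p q \<le> 1"
proof -
  show "0 \<le> bsc_compose p q"
    using assms by (simp add: bsc_compose_def)
  have "0 \<le> p * q + (1 - p) * (1 - q)"
    using assms by simp
  then show "bsc_compose p q \<le> 1"
    by (simp add: bsc_compose_def algebra_simps)
qed

text \<open>The XOR of two independent noise words is again memoryless noise. \<open>F\<close> is
  arbitrary in the induction because the leading bit of the XOR is absorbed into it; the four
  combinations of leading bits group into the weights \<open>bsc_compose p q\<close> and its
  complement.\<close>

lemma sum_err_prob_bxor:
  "(\<Sum>e\<in>words n. \<Sum>e'\<in>words n. err_prob p e * err_prob q e' * F (bxor e e'))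
   = (\<Sum>s\<in>words n. err_prob (bsc_compose p q) s * F s)"
proof (induction n arbitrary: F)
  case 0
  show ?case by (simp add: words_0 bxor_def)
next
  case (Suc n)
  have bxor_Cons: "bxor (a # x) (b # y) = (a \<noteq> b) # bxor x y" for a b x y
    by (simp add: bxor_def)
  let ?T = "\<Sum>s\<in>words n. err_prob (bsc_compose p q) s * F (True # s)"
  let ?F = "\<Sum>s\<in>words n. err_prob (bsc_compose p q) s * F (False # s)"
  have sc: "(\<Sum>e\<in>words n. \<Sum>e'\<in>words n. (c * err_prob p e) * (c' * err_prob q e') * G (bxor e e'))
      = c * c' * (\<Sum>s\<in>words n. err_prob (bsc_compose p q) s * G s)" for c c' and G :: "bool list \<Rightarrow> real"
    unfolding Suc.IH[symmetric] sum_distrib_left by (simp add: ac_simps)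
  have "(\<Sum>e\<in>words (Suc n). \<Sum>e'\<in>words (Suc n). err_prob p e * err_prob q e' * F (bxor e e'))
     = p * q * ?F + p * (1 - q) * ?T + ((1 - p) * q * ?T + (1 - p) * (1 - q) * ?F)"
    by (simp add: sum_words_Suc bxor_Cons sum.distrib
        sc[where G = "\<lambda>s. F (True # s)"] sc[where G = "\<lambda>s. F (False # s)"])
  also have "\<dots> = bsc_compose p q * ?T + (1 - bsc_compose p q) * ?F"
    by (simp add: bsc_compose_def algebra_simps)
  also have "\<dots> = (\<Sum>s\<in>words (Suc n). err_prob (bsc_compose p q) s * F s)"
    by (simp add: sum_words_Suc sum_distrib_left ac_simps)
  finally show ?case .
qed

text \<open>The noise of the three links leading to \<open>y34\<close> enters only through its XOR,
  so two applications of \<open>sum_err_prob_bxor\<close> merge it into the single word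
  \<open>e'\<close>.\<close>

lemma joint_err_eq:
  "joint_err p13 p14 p23 p34 n MA MB f g d =
     1 / (real MA * real MB) *
     (\<Sum>a\<in>{1..MA}. \<Sum>b\<in>{1..MB}. \<Sum>e\<in>words n. \<Sum>e'\<in>words n.
        err_prob p14 e * err_prob (bsc_compose (bsc_compose p13 p23) p34) e' *
        of_bool (d (bxor (f a) e) (bxor (f a) (bxor (g b) e')) \<noteq> (a, b)))"
proof -
  have "(\<Sum>e13\<in>words n. \<Sum>e14\<in>words n. \<Sum>e23\<in>words n. \<Sum>e34\<in>words n.
          err_prob p13 e13 * err_prob p14 e14 * err_prob p23 e23 * err_prob p34 e34 *
          (let y14 = bxor (f a) e14;
               y34 = bxor (bxor (bxor (f a) e13) (bxor (g b) e23)) e34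
           in if d y14 y34 \<noteq> (a, b) then 1 else 0))
    = (\<Sum>e\<in>words n. \<Sum>e'\<in>words n.
        err_prob p14 e * err_prob (bsc_compose (bsc_compose p13 p23) p34) e' *
        of_bool (d (bxor (f a) e) (bxor (f a) (bxor (g b) e')) \<noteq> (a, b)))" (is "?L = ?R") for a b
  proof -
    define F where "F e s = (of_bool (d (bxor (f a) e) (bxor (f a) (bxor (g b) s)) \<noteq> (a, b)) :: real)" for e s
    have F: "(let y14 = bxor (f a) e14; y34 = bxor (bxor (bxor (f a) e13) (bxor (g b) e23)) e34
           in if d y14 y34 \<noteq> (a, b) then 1 else 0) = F e14 (bxor (bxor e13 e23) e34)" for e13 e14 e23 e34
      by (simp add: F_def Let_def bxor_ac)
    have "?L = (\<Sum>e14\<in>words n. \<Sum>e13\<in>words n. \<Sum>e23\<in>words n. \<Sum>e34\<in>words n.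
          err_prob p13 e13 * err_prob p14 e14 * err_prob p23 e23 * err_prob p34 e34 *
          F e14 (bxor (bxor e13 e23) e34))"
      unfolding F by (rule sum.swap)
    also have "\<dots> = (\<Sum>e14\<in>words n. err_prob p14 e14 * (\<Sum>e13\<in>words n. \<Sum>e23\<in>words n.
          err_prob p13 e13 * err_prob p23 e23 *
            (\<Sum>e34\<in>words n. err_prob p34 e34 * F e14 (bxor (bxor e13 e23) e34))))"
      by (simp add: sum_distrib_left ac_simps)
    also have "\<dots> = (\<Sum>e14\<in>words n. err_prob p14 e14 * (\<Sum>s\<in>words n. \<Sum>e34\<in>words n.
          err_prob (bsc_compose p13 p23) s * err_prob p34 e34 * F e14 (bxor s e34)))"
      by (subst sum_err_prob_bxor) (simp add: sum_distrib_left ac_simps)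
    also have "\<dots> = (\<Sum>e14\<in>words n. err_prob p14 e14 * (\<Sum>s\<in>words n.
          err_prob (bsc_compose (bsc_compose p13 p23) p34) s * F e14 s))"
      by (subst sum_err_prob_bxor) simp
    also have "\<dots> = ?R"
      by (simp add: sum_distrib_left ac_simps F_def)
    finally show ?thesis .
  qed
  then show ?thesis
    by (simp add: joint_err_def)
qed

section \<open>Typical noise\<close>

text \<open>For independent letters of mean zero the cross terms vanish, so variances add.
  \<open>shift1\<close> and \<open>shift2\<close> split off the first letter, with value
  \<open>y\<close> and probability \<open>x\<close>.\<close>

lemma noise_moments:
  fixes c :: "bool \<Rightarrow> real"
  assumes "p * c True + (1 - p) * c False = 0"
  shows "(\<Sum>e\<in>words n. err_prob p e * sum_list (map c e)) = 0"
    and "(\<Sum>e\<in>words n. err_prob p e * (sum_list (map c e))\<^sup>2)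
         = real n * (p * (c True)\<^sup>2 + (1 - p) * (c False)\<^sup>2)"
proof -
  have shift1: "(\<Sum>e\<in>words n. x * err_prob p e * (y + sum_list (map c e)))
      = x * (y + (\<Sum>e\<in>words n. err_prob p e * sum_list (map c e)))" for x y n
  proof -
    have "x * (y + (\<Sum>e\<in>words n. err_prob p e * sum_list (map c e)))
        = x * ((\<Sum>e\<in>words n. err_prob p e * y) + (\<Sum>e\<in>words n. err_prob p e * sum_list (map c e)))"
      by (simp add: sum_distrib_right[symmetric] sum_err_prob)
    then show ?thesis
      by (simp add: sum.distrib[symmetric] sum_distrib_left algebra_simps)
  qed
  show m1: "(\<Sum>e\<in>words n. err_prob p e * sum_list (map c e)) = 0" for n
    by (induction n) (use assms in \<open>simp_all add: words_0 sum_words_Suc shift1\<close>)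
  have shift2: "(\<Sum>e\<in>words n. x * err_prob p e * (y + sum_list (map c e))\<^sup>2)
      = x * (y\<^sup>2 + (\<Sum>e\<in>words n. err_prob p e * (sum_list (map c e))\<^sup>2))" for x y n
  proof -
    have "x * (y\<^sup>2 + (\<Sum>e\<in>words n. err_prob p e * (sum_list (map c e))\<^sup>2))
        = x * ((\<Sum>e\<in>words n. err_prob p e * y\<^sup>2)
             + 2 * y * (\<Sum>e\<in>words n. err_prob p e * sum_list (map c e))
             + (\<Sum>e\<in>words n. err_prob p e * (sum_list (map c e))\<^sup>2))"
      by (simp add: m1 sum_distrib_right[symmetric] sum_err_prob)
    then show ?thesis
      by (simp add: sum.distrib[symmetric] sum_distrib_left algebra_simps power2_sum)
  qed
  show "(\<Sum>e\<in>words n. err_prob p e * (sum_list (map c e))\<^sup>2)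
         = real n * (p * (c True)\<^sup>2 + (1 - p) * (c False)\<^sup>2)"
    by (induction n) (simp_all add: words_0 sum_words_Suc shift2, simp add: algebra_simps)
qed

text \<open>Weak typicality: the probability of the word is constrained, not its number of ones. The
  lower bound is positive, so words of probability zero are never typical and the crossover
  probabilities 0 and 1 need no separate treatment.\<close>

definition typical :: "real \<Rightarrow> real \<Rightarrow> nat \<Rightarrow> bool list set" where
  "typical p \<delta> n = {e \<in> words n. 2 powr (- real n * (Hb p + \<delta>)) \<le> err_prob p e
                             \<and> err_prob p e \<le> 2 powr (- real n * (Hb p - \<delta>))}"

definition atypical_prob :: "real \<Rightarrow> real \<Rightarrow> nat \<Rightarrow> real" where
  "atypical_prob p \<delta> n = (\<Sum>e\<in>words n. err_prob p e * of_bool (e \<notin> typical p \<delta> n))"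

lemma typical_subset_words: "typical p \<delta> n \<subseteq> words n"
  by (auto simp: typical_def)

lemma err_prob_typical_le: "e \<in> typical p \<delta> n \<Longrightarrow> err_prob p e \<le> 2 powr (- real n * (Hb p - \<delta>))"
  by (simp add: typical_def)

lemma log_err_prob:
  assumes "0 \<le> p" "p \<le> 1" "0 < err_prob p e"
  shows "log 2 (err_prob p e) = sum_list (map (\<lambda>b. log 2 (if b then p else 1 - p)) e)"
  using assms(3)
proof (induction e)
  case (Cons b e)
  have "0 \<le> err_prob p e"
    using assms by (intro err_prob_nonneg)
  with Cons.prems assms have "0 < err_prob p e" "0 < (if b then p else 1 - p)"
    by (auto simp: zero_less_mult_iff split: if_splits)
  with Cons.IH show ?case
    by (auto simp: log_mult)
qed simp

text \<open>Chebyshev for the log-probability: \<open>c\<close> is the centred logarithm of the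
  probability of one letter, \<open>V\<close> its variance. An atypical word of positive probability
  has a log-probability at distance at least n * \<delta> from - n * Hb p; words of probability zero
  contribute nothing to either side.\<close>

lemma atypical_prob_le:
  assumes p: "0 \<le> p" "p \<le> 1" and \<delta>: "0 < \<delta>" and n: "0 < n"
  defines "V \<equiv> p * (log 2 p + Hb p)\<^sup>2 + (1 - p) * (log 2 (1 - p) + Hb p)\<^sup>2"
  shows "atypical_prob p \<delta> n \<le> V / (real n * \<delta>\<^sup>2)"
proof -
  define c where "c b = log 2 (if b then p else 1 - p) + Hb p" for b
  have mean: "p * c True + (1 - p) * c False = 0"
    by (simp add: c_def Hb_def algebra_simps)
  have sum_c: "sum_list (map c e) = log 2 (err_prob p e) + real n * Hb p"
    if "e \<in> words n" "0 < err_prob p e" for e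
    using that log_err_prob[OF p that(2)]
    by (simp add: c_def[abs_def] sum_list_addf sum_list_triv words_def)
  have "(real n * \<delta>)\<^sup>2 * atypical_prob p \<delta> n
      = (\<Sum>e\<in>words n. err_prob p e * ((real n * \<delta>)\<^sup>2 * of_bool (e \<notin> typical p \<delta> n)))"
    by (simp add: atypical_prob_def sum_distrib_left ac_simps)
  also have "\<dots> \<le> (\<Sum>e\<in>words n. err_prob p e * (sum_list (map c e))\<^sup>2)"
  proof (rule sum_mono)
    fix e assume e: "e \<in> words n"
    show "err_prob p e * ((real n * \<delta>)\<^sup>2 * of_bool (e \<notin> typical p \<delta> n))
        \<le> err_prob p e * (sum_list (map c e))\<^sup>2"
    proof (cases "e \<notin> typical p \<delta> n \<and> err_prob p e \<noteq> 0")
      case True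
      then have pos: "0 < err_prob p e"
        using err_prob_nonneg[OF p, of e] by simp
      have "real n * \<delta> \<le> \<bar>log 2 (err_prob p e) + real n * Hb p\<bar>"
        using True e pos by (auto simp: typical_def powr_le_iff le_powr_iff algebra_simps)
      then have "(real n * \<delta>)\<^sup>2 \<le> (sum_list (map c e))\<^sup>2"
        unfolding sum_c[OF e pos] using \<delta> by (simp add: abs_le_square_iff[symmetric] abs_mult)
      with True pos show ?thesis by simp
    qed (use err_prob_nonneg[OF p, of e] in auto)
  qed
  also have "\<dots> = real n * V"
    unfolding noise_moments(2)[OF mean] by (simp add: c_def V_def)
  finally show ?thesis
    using n \<delta> by (simp add: field_simps power2_eq_square)
qed

lemma tendsto_atypical_prob:
  assumes p: "0 \<le> p" "p \<le> 1" and \<delta>: "0 < \<delta>"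
  shows "(atypical_prob p \<delta>) \<longlonglongrightarrow> 0"
proof -
  define V where "V = p * (log 2 p + Hb p)\<^sup>2 + (1 - p) * (log 2 (1 - p) + Hb p)\<^sup>2"
  have "(\<lambda>n. V / \<delta>\<^sup>2 * inverse (real n)) \<longlonglongrightarrow> V / \<delta>\<^sup>2 * 0"
    by (intro tendsto_intros lim_inverse_n)
  then have lim: "(\<lambda>n. V / (real n * \<delta>\<^sup>2)) \<longlonglongrightarrow> 0"
    by (simp add: field_simps)
  show ?thesis
  proof (rule tendsto_sandwich[OF _ _ tendsto_const lim])
    show "\<forall>\<^sub>F n in sequentially. 0 \<le> atypical_prob p \<delta> n"
      unfolding atypical_prob_def
      by (intro always_eventually allI sum_nonneg mult_nonneg_nonneg err_prob_nonneg p) simp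
    show "\<forall>\<^sub>F n in sequentially. atypical_prob p \<delta> n \<le> V / (real n * \<delta>\<^sup>2)"
      using eventually_gt_at_top[of 0]
      by eventually_elim (use atypical_prob_le[OF p \<delta>] in \<open>simp add: V_def\<close>)
  qed
qed

lemma card_typical_le:
  assumes p: "0 \<le> p" "p \<le> 1"
  shows "real (card (typical p \<delta> n)) \<le> 2 powr (real n * (Hb p + \<delta>))"
proof -
  have "real (card (typical p \<delta> n)) * 2 powr (- real n * (Hb p + \<delta>))
      = (\<Sum>e\<in>typical p \<delta> n. 2 powr (- real n * (Hb p + \<delta>)))"
    by simp
  also have "\<dots> \<le> (\<Sum>e\<in>typical p \<delta> n. err_prob p e)"
    by (rule sum_mono) (simp add: typical_def)
  also have "\<dots> \<le> (\<Sum>e\<in>words n. err_prob p e)"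
    by (rule sum_mono2) (auto simp: typical_def err_prob_nonneg p)
  finally show ?thesis
    by (simp only: sum_err_prob powr_minus mult_minus_left) (simp add: field_simps)
qed

section \<open>Converse\<close>

text \<open>Every bound of the converse counts correctly decoded pairs of message and typical noise: for a
  fixed message the received word is a translate of the noise, and each received word is decoded
  only once.\<close>

definition success_sum ::
  "real \<Rightarrow> real \<Rightarrow> nat \<Rightarrow> nat \<Rightarrow> nat \<Rightarrow>
   (nat \<Rightarrow> bool list) \<Rightarrow> (nat \<Rightarrow> bool list) \<Rightarrow> (bool list \<Rightarrow> bool list \<Rightarrow> nat \<times> nat) \<Rightarrow> real" where
  "success_sum p q n MA MB f g d =
     (\<Sum>a\<in>{1..MA}. \<Sum>b\<in>{1..MB}. \<Sum>e\<in>words n. \<Sum>e'\<in>words n.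
        err_prob p e * err_prob q e' *
        of_bool (d (bxor (f a) e) (bxor (f a) (bxor (g b) e')) = (a, b)))"

lemma joint_err_success_sum:
  assumes "0 < MA" "0 < MB"
  shows "success_sum p14 (bsc_compose (bsc_compose p13 p23) p34) n MA MB f g d =
         (1 - joint_err p13 p14 p23 p34 n MA MB f g d) * (real MA * real MB)"
proof -
  let ?p' = "bsc_compose (bsc_compose p13 p23) p34"
  have "joint_err p13 p14 p23 p34 n MA MB f g d * (real MA * real MB) =
     (\<Sum>a\<in>{1..MA}. \<Sum>b\<in>{1..MB}. \<Sum>e\<in>words n. \<Sum>e'\<in>words n. err_prob p14 e * err_prob ?p' e' *
        of_bool (d (bxor (f a) e) (bxor (f a) (bxor (g b) e')) \<noteq> (a, b)))"
    using assms by (simp add: joint_err_eq)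
  then have "success_sum p14 ?p' n MA MB f g d + joint_err p13 p14 p23 p34 n MA MB f g d * (real MA * real MB)
    = (\<Sum>a\<in>{1..MA}. \<Sum>b\<in>{1..MB}. \<Sum>e\<in>words n. \<Sum>e'\<in>words n. err_prob p14 e * err_prob ?p' e')"
    unfolding success_sum_def by (simp add: sum.distrib[symmetric] distrib_left[symmetric] of_bool_not_iff)
  also have "\<dots> = real MA * real MB"
    by (simp add: sum_distrib_left[symmetric] sum_err_prob)
  finally show ?thesis
    by (simp add: algebra_simps)
qed

lemma sum_of_bool_eq_le_1:
  "(\<Sum>a\<in>A. of_bool (x = a)) \<le> (1 :: real)"
proof (cases "finite A")
  case True
  then show ?thesis by (simp add: of_bool_def if_distrib sum.delta' cong: if_cong)
qed simp

lemma sum_decoded_le: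
  assumes "\<And>m. m \<in> M \<Longrightarrow> h m \<in> words n"
  shows "(\<Sum>m\<in>M. \<Sum>e\<in>words n. of_bool (D (bxor (h m) e) = k m)) \<le>
    (\<Sum>y\<in>words n. \<Sum>m\<in>M. of_bool (D y = k m) :: real)"
proof -
  have "(\<Sum>m\<in>M. \<Sum>e\<in>words n. of_bool (D (bxor (h m) e) = k m)) =
    (\<Sum>m\<in>M. \<Sum>y\<in>words n. of_bool (D y = k m) :: real)"
    by (intro sum.cong refl sum_words_bxor assms)
  also have "\<dots> = (\<Sum>y\<in>words n. \<Sum>m\<in>M. of_bool (D y = k m))"
    by (rule sum.swap)
  finally show ?thesis by simp
qed

lemma noise_sum_fst: "(\<Sum>e\<in>words n. \<Sum>e'\<in>words n. err_prob p e * err_prob q e' * F e)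
    = (\<Sum>e\<in>words n. err_prob p e * F e)"
  by (simp add: sum_distrib_left[symmetric] sum_distrib_right[symmetric] sum_err_prob)

lemma noise_sum_snd: "(\<Sum>e\<in>words n. \<Sum>e'\<in>words n. err_prob p e * err_prob q e' * F e')
    = (\<Sum>e'\<in>words n. err_prob q e' * F e')"
  by (simp add: mult.assoc sum_distrib_left[symmetric] sum_distrib_right[symmetric] sum_err_prob)

section \<open>Three counting bounds on correct decoding\<close>

context
  fixes p q \<delta> :: real and n MA MB :: nat and f g :: "nat \<Rightarrow> bool list"
    and d :: "bool list \<Rightarrow> bool list \<Rightarrow> nat \<times> nat"
  assumes p: "0 \<le> p" "p \<le> 1" and q: "0 \<le> q" "q \<le> 1"
    and f: "\<And>a. a \<in> {1..MA} \<Longrightarrow> f a \<in> words n"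
    and g: "\<And>b. b \<in> {1..MB} \<Longrightarrow> g b \<in> words n"
begin

abbreviation "correct a b e e' \<equiv> of_bool (d (bxor (f a) e) (bxor (f a) (bxor (g b) e')) = (a, b)) :: real"

lemma err_prob_prod_le:
  assumes "e \<in> typical p \<delta> n" "e' \<in> typical q \<delta> n"
  shows "err_prob p e * err_prob q e' \<le> 2 powr (- real n * (Hb p + Hb q - 2 * \<delta>))"
proof -
  have "err_prob p e * err_prob q e' \<le> 2 powr (- real n * (Hb p - \<delta>)) * 2 powr (- real n * (Hb q - \<delta>))"
    by (intro mult_mono err_prob_typical_le assms err_prob_nonneg q) simp
  then show ?thesis
    by (simp add: powr_add[symmetric] algebra_simps)
qed

text \<open>There are 4^n pairs of received words, each decoded to one message pair, and a typical
  noise pair weighs at most \<open>K\<close>, at the cost of one \<delta> per noise word.\<close>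

lemma success_sum_le_total:
  "success_sum p q n MA MB f g d \<le>
     2 powr (real n * (2 - Hb p - Hb q + 2 * \<delta>))
     + real MA * real MB * (atypical_prob p \<delta> n + atypical_prob q \<delta> n)"
proof -
  define K where "K = 2 powr (- real n * (Hb p + Hb q - 2 * \<delta>))"
  \<comment> \<open>Termwise: a typical pair weighs at most \<open>K\<close>; otherwise the
    correctness indicator is bounded by one and the term is charged to an atypical word. The two
    bounds for a single message begin with the same split.\<close>
  have "success_sum p q n MA MB f g d \<le> (\<Sum>a\<in>{1..MA}. \<Sum>b\<in>{1..MB}. \<Sum>e\<in>words n. \<Sum>e'\<in>words n.
      K * correct a b e e' + (err_prob p e * err_prob q e' * of_bool (e \<notin> typical p \<delta> n)
        + err_prob p e * err_prob q e' * of_bool (e' \<notin> typical q \<delta> n)))"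
    unfolding success_sum_def
  proof (intro sum_mono)
    fix a b e e'
    have "0 \<le> err_prob p e * err_prob q e'"
      by (simp add: err_prob_nonneg p q)
    then show "err_prob p e * err_prob q e' * correct a b e e' \<le>
      K * correct a b e e' + (err_prob p e * err_prob q e' * of_bool (e \<notin> typical p \<delta> n)
        + err_prob p e * err_prob q e' * of_bool (e' \<notin> typical q \<delta> n))"
      using err_prob_prod_le[of e e'] by (cases "e \<in> typical p \<delta> n"; cases "e' \<in> typical q \<delta> n")
        (auto simp: of_bool_def K_def)
  qed
  also have "\<dots> = K * (\<Sum>a\<in>{1..MA}. \<Sum>b\<in>{1..MB}. \<Sum>e\<in>words n. \<Sum>e'\<in>words n. correct a b e e')
     + real MA * real MB * (atypical_prob p \<delta> n + atypical_prob q \<delta> n)"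
    unfolding sum.distrib noise_sum_fst noise_sum_snd atypical_prob_def[symmetric]
    by (simp add: sum_distrib_left[symmetric] algebra_simps)
  also have "(\<Sum>a\<in>{1..MA}. \<Sum>b\<in>{1..MB}. \<Sum>e\<in>words n. \<Sum>e'\<in>words n. correct a b e e')
      = (\<Sum>a\<in>{1..MA}. \<Sum>b\<in>{1..MB}. \<Sum>y\<in>words n. \<Sum>z\<in>words n. of_bool (d y z = (a, b)))"
  proof (rule sum.cong[OF refl], rule sum.cong[OF refl])
    fix a b assume ab: "a \<in> {1..MA}" "b \<in> {1..MB}"
    have "(\<Sum>e\<in>words n. \<Sum>e'\<in>words n. correct a b e e')
      = (\<Sum>e\<in>words n. \<Sum>z\<in>words n. of_bool (d (bxor (f a) e) z = (a, b)) :: real)"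
    proof (rule sum.cong[OF refl])
      fix e
      show "(\<Sum>e'\<in>words n. correct a b e e') = (\<Sum>z\<in>words n. of_bool (d (bxor (f a) e) z = (a, b)))"
        using sum_words_bxor[OF bxor_in_words[OF f[OF ab(1)] g[OF ab(2)]],
            of "\<lambda>z. of_bool (d (bxor (f a) e) z = (a, b))"]
        by (simp add: bxor_assoc)
    qed
    also have "\<dots> = (\<Sum>y\<in>words n. \<Sum>z\<in>words n. of_bool (d y z = (a, b)))"
      by (rule sum_words_bxor[OF f[OF ab(1)]])
    finally show "(\<Sum>e\<in>words n. \<Sum>e'\<in>words n. correct a b e e') =
      (\<Sum>y\<in>words n. \<Sum>z\<in>words n. of_bool (d y z = (a, b)) :: real)" .
  qed
  also have "\<dots> = (\<Sum>m\<in>{1..MA} \<times> {1..MB}. \<Sum>y\<in>words n. \<Sum>z\<in>words n. of_bool (d y z = m))"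
    unfolding sum.cartesian_product[where A = "{1..MA}"] by (rule sum.cong) auto
  also have "\<dots> = (\<Sum>y\<in>words n. \<Sum>z\<in>words n. \<Sum>m\<in>{1..MA} \<times> {1..MB}. of_bool (d y z = m))"
    by (rule trans[OF sum.swap sum.cong[OF refl sum.swap]])
  also have "\<dots> \<le> (\<Sum>y\<in>words n. \<Sum>z\<in>words n. 1)"
    by (intro sum_mono sum_of_bool_eq_le_1)
  also have "\<dots> = 2 powr (2 * real n)"
    by (simp add: card_words powr_realpow[symmetric] powr_add[symmetric])
  finally show ?thesis
    by (simp add: K_def powr_add[symmetric] algebra_simps)
qed

text \<open>Genie argument: with \<open>a\<close> and \<open>e\<close> fixed, the first received
  word is fixed too, and only the 2^n values of the second remain to separate the values of
  \<open>b\<close>. The weight of \<open>e\<close> stays in the sum and adds up to one.\<close>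

lemma success_sum_le_B:
  "success_sum p q n MA MB f g d \<le>
     real MA * 2 powr (real n * (1 - Hb q + \<delta>)) + real MA * real MB * atypical_prob q \<delta> n"
proof -
  define K where "K = 2 powr (- real n * (Hb q - \<delta>))"
  have "success_sum p q n MA MB f g d \<le> (\<Sum>a\<in>{1..MA}. \<Sum>b\<in>{1..MB}. \<Sum>e\<in>words n. \<Sum>e'\<in>words n.
      K * (err_prob p e * correct a b e e') + err_prob p e * err_prob q e' * of_bool (e' \<notin> typical q \<delta> n))"
    unfolding success_sum_def
  proof (intro sum_mono)
    fix a b e e'
    have "0 \<le> err_prob p e * err_prob q e'" "0 \<le> err_prob p e" "0 \<le> K"
      by (simp_all add: err_prob_nonneg p q K_def)
    moreover have "err_prob p e * err_prob q e' \<le> err_prob p e * K" if "e' \<in> typical q \<delta> n"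
      using that unfolding K_def by (intro mult_left_mono err_prob_typical_le err_prob_nonneg p)
    ultimately show "err_prob p e * err_prob q e' * correct a b e e' \<le>
      K * (err_prob p e * correct a b e e') + err_prob p e * err_prob q e' * of_bool (e' \<notin> typical q \<delta> n)"
      by (cases "e' \<in> typical q \<delta> n") (auto simp: of_bool_def mult.commute)
  qed
  also have "\<dots> = K * (\<Sum>a\<in>{1..MA}. \<Sum>e\<in>words n. err_prob p e *
        (\<Sum>b\<in>{1..MB}. \<Sum>e'\<in>words n. correct a b e e'))
     + real MA * real MB * atypical_prob q \<delta> n"
    by (subst (2) sum_distrib_left, subst (2) sum.swap)
      (simp add: sum.distrib noise_sum_snd sum_distrib_left[symmetric] atypical_prob_def)
  also have "(\<Sum>a\<in>{1..MA}. \<Sum>e\<in>words n. err_prob p e * (\<Sum>b\<in>{1..MB}. \<Sum>e'\<in>words n. correct a b e e'))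
     \<le> (\<Sum>a\<in>{1..MA}. \<Sum>e\<in>words n. err_prob p e * 2 powr real n)"
  proof (intro sum_mono mult_left_mono err_prob_nonneg p)
    fix a e assume a: "a \<in> {1..MA}"
    have "(\<Sum>b\<in>{1..MB}. \<Sum>e'\<in>words n. correct a b e e')
       \<le> (\<Sum>z\<in>words n. \<Sum>b\<in>{1..MB}. of_bool (d (bxor (f a) e) z = (a, b)) :: real)"
      using sum_decoded_le[of "{1..MB}" "\<lambda>b. bxor (f a) (g b)" n "d (bxor (f a) e)" "Pair a"]
      by (simp add: bxor_assoc bxor_in_words f[OF a] g)
    also have "\<dots> \<le> (\<Sum>z\<in>words n. 1)"
    proof (rule sum_mono)
      fix z
      have "(\<Sum>b\<in>{1..MB}. of_bool (d (bxor (f a) e) z = (a, b)) :: real)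
         \<le> (\<Sum>b\<in>{1..MB}. of_bool (snd (d (bxor (f a) e) z) = b))"
        by (intro sum_mono) (auto simp: of_bool_def)
      then show "(\<Sum>b\<in>{1..MB}. of_bool (d (bxor (f a) e) z = (a, b))) \<le> (1 :: real)"
        by (rule order_trans[OF _ sum_of_bool_eq_le_1])
    qed
    also have "\<dots> = 2 powr real n"
      by (simp add: card_words powr_realpow)
    finally show "(\<Sum>b\<in>{1..MB}. \<Sum>e'\<in>words n. correct a b e e') \<le> 2 powr real n" .
  qed
  also have "\<dots> = real MA * 2 powr real n"
    by (simp add: sum_distrib_right[symmetric] sum_err_prob)
  finally show ?thesis
    by (simp add: K_def powr_add[symmetric] algebra_simps)
qed

text \<open>For fixed \<open>b\<close> a pair of received words amounts to the first word
  \<open>y\<close> and the noise sum \<open>s\<close>, because the second word is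
  \<open>bxor (g b) (bxor s y)\<close>. Counting only typical \<open>s\<close> costs one \<delta>,
  and the two noise words in \<open>K\<close> cost one each.\<close>

lemma success_sum_le_A:
  "success_sum p q n MA MB f g d \<le>
     real MB * 2 powr (real n * (1 + Hb (bsc_compose p q) - Hb p - Hb q + 3 * \<delta>))
     + real MA * real MB * (atypical_prob p \<delta> n + atypical_prob q \<delta> n + atypical_prob (bsc_compose p q) \<delta> n)"
proof -
  define K where "K = 2 powr (- real n * (Hb p + Hb q - 2 * \<delta>))"
  let ?r = "bsc_compose p q"
  let ?T = "typical ?r \<delta> n"
  have r: "0 \<le> ?r" "?r \<le> 1"
    using bsc_compose_bounds[OF p q] by auto
  have "success_sum p q n MA MB f g d \<le> (\<Sum>a\<in>{1..MA}. \<Sum>b\<in>{1..MB}. \<Sum>e\<in>words n. \<Sum>e'\<in>words n.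
      K * (of_bool (bxor e e' \<in> ?T) * correct a b e e')
        + (err_prob p e * err_prob q e' * of_bool (e \<notin> typical p \<delta> n)
        + err_prob p e * err_prob q e' * of_bool (e' \<notin> typical q \<delta> n)
        + err_prob p e * err_prob q e' * of_bool (bxor e e' \<notin> ?T)))"
    unfolding success_sum_def
  proof (intro sum_mono)
    fix a b e e'
    have "0 \<le> err_prob p e * err_prob q e'"
      by (simp add: err_prob_nonneg p q)
    then show "err_prob p e * err_prob q e' * correct a b e e' \<le>
      K * (of_bool (bxor e e' \<in> ?T) * correct a b e e')
        + (err_prob p e * err_prob q e' * of_bool (e \<notin> typical p \<delta> n)
        + err_prob p e * err_prob q e' * of_bool (e' \<notin> typical q \<delta> n)
        + err_prob p e * err_prob q e' * of_bool (bxor e e' \<notin> ?T))"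
      using err_prob_prod_le[of e e']
      by (cases "e \<in> typical p \<delta> n"; cases "e' \<in> typical q \<delta> n"; cases "bxor e e' \<in> ?T")
        (auto simp: of_bool_def K_def)
  qed
  also have "\<dots> = K * (\<Sum>a\<in>{1..MA}. \<Sum>b\<in>{1..MB}. \<Sum>e\<in>words n. \<Sum>e'\<in>words n.
        of_bool (bxor e e' \<in> ?T) * correct a b e e')
     + real MA * real MB * (atypical_prob p \<delta> n + atypical_prob q \<delta> n + atypical_prob ?r \<delta> n)"
    unfolding sum.distrib noise_sum_fst noise_sum_snd atypical_prob_def[symmetric]
      sum_err_prob_bxor[where F = "\<lambda>s. of_bool (s \<notin> ?T)"]
    by (simp add: sum_distrib_left[symmetric] distrib_left)
  also have "(\<Sum>a\<in>{1..MA}. \<Sum>b\<in>{1..MB}. \<Sum>e\<in>words n. \<Sum>e'\<in>words n.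
        of_bool (bxor e e' \<in> ?T) * correct a b e e')
    = (\<Sum>b\<in>{1..MB}. \<Sum>a\<in>{1..MA}. \<Sum>e\<in>words n. \<Sum>e'\<in>words n.
        of_bool (bxor e e' \<in> ?T) * correct a b e e')"
    by (rule sum.swap)
  also have "(\<Sum>b\<in>{1..MB}. \<Sum>a\<in>{1..MA}. \<Sum>e\<in>words n. \<Sum>e'\<in>words n.
        of_bool (bxor e e' \<in> ?T) * correct a b e e')
     \<le> (\<Sum>b\<in>{1..MB}. 2 powr real n * card ?T)"
  proof (rule sum_mono)
    fix b
    \<comment> \<open>Substitution of \<open>s\<close> for \<open>e'\<close>, a bijection for fixed
      \<open>e\<close>. Afterwards, for fixed \<open>s\<close>, both arguments of the decoder are
      functions of the first received word alone.\<close>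
    have "(\<Sum>e'\<in>words n. of_bool (bxor e e' \<in> ?T) * correct a b e e')
       = (\<Sum>s\<in>words n. of_bool (s \<in> ?T) *
           of_bool (d (bxor (f a) e) (bxor (g b) (bxor s (bxor (f a) e))) = (a, b)))"
      if "e \<in> words n" for a e
    proof (rule trans[OF _ sum_words_bxor[OF that]], rule sum.cong[OF refl])
      fix e' assume "e' \<in> words n"
      then have e': "bxor e (bxor e e') = e'"
        by (rule bxor_words_cancel[OF that])
      have "bxor (g b) (bxor (bxor e e') (bxor (f a) e)) = bxor (f a) (bxor (g b) (bxor e (bxor e e')))"
        by (simp add: bxor_ac)
      then have "bxor (f a) (bxor (g b) e') = bxor (g b) (bxor (bxor e e') (bxor (f a) e))"
        unfolding e' by simp
      then show "of_bool (bxor e e' \<in> ?T) * correct a b e e' = of_bool (bxor e e' \<in> ?T) *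
           of_bool (d (bxor (f a) e) (bxor (g b) (bxor (bxor e e') (bxor (f a) e))) = (a, b))"
        by simp
    qed
    then have "(\<Sum>a\<in>{1..MA}. \<Sum>e\<in>words n. \<Sum>e'\<in>words n. of_bool (bxor e e' \<in> ?T) * correct a b e e')
      = (\<Sum>a\<in>{1..MA}. \<Sum>e\<in>words n. \<Sum>s\<in>words n. of_bool (s \<in> ?T) *
           of_bool (d (bxor (f a) e) (bxor (g b) (bxor s (bxor (f a) e))) = (a, b)) :: real)"
      by simp
    also have "\<dots> = (\<Sum>s\<in>words n. of_bool (s \<in> ?T) * (\<Sum>a\<in>{1..MA}. \<Sum>e\<in>words n.
           of_bool (d (bxor (f a) e) (bxor (g b) (bxor s (bxor (f a) e))) = (a, b))))"
      unfolding sum_distrib_left by (rule trans[OF sum.cong[OF refl sum.swap] sum.swap])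
    also have "\<dots> \<le> (\<Sum>s\<in>words n. of_bool (s \<in> ?T) * 2 powr real n)"
    proof (intro sum_mono mult_left_mono)
      fix s
      have "(\<Sum>a\<in>{1..MA}. \<Sum>e\<in>words n.
           of_bool (d (bxor (f a) e) (bxor (g b) (bxor s (bxor (f a) e))) = (a, b)))
         \<le> (\<Sum>y\<in>words n. \<Sum>a\<in>{1..MA}. of_bool (d y (bxor (g b) (bxor s y)) = (a, b)) :: real)"
        using sum_decoded_le[of "{1..MA}" f n "\<lambda>y. d y (bxor (g b) (bxor s y))" "\<lambda>a. (a, b)"] f
        by simp
      also have "\<dots> \<le> (\<Sum>y\<in>words n. 1)"
      proof (rule sum_mono)
        fix y
        have "(\<Sum>a\<in>{1..MA}. of_bool (d y (bxor (g b) (bxor s y)) = (a, b)) :: real)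
           \<le> (\<Sum>a\<in>{1..MA}. of_bool (fst (d y (bxor (g b) (bxor s y))) = a))"
          by (intro sum_mono) (auto simp: of_bool_def)
        then show "(\<Sum>a\<in>{1..MA}. of_bool (d y (bxor (g b) (bxor s y)) = (a, b))) \<le> (1 :: real)"
          by (rule order_trans[OF _ sum_of_bool_eq_le_1])
      qed
      also have "\<dots> = 2 powr real n"
        by (simp add: card_words powr_realpow)
      finally show "(\<Sum>a\<in>{1..MA}. \<Sum>e\<in>words n.
           of_bool (d (bxor (f a) e) (bxor (g b) (bxor s (bxor (f a) e))) = (a, b))) \<le> 2 powr real n" .
    qed simp
    also have "\<dots> = 2 powr real n * card ?T"
      by (simp add: sum_distrib_right[symmetric] sum_of_bool_eq Int_absorb1[OF typical_subset_words])
    finally show "(\<Sum>a\<in>{1..MA}. \<Sum>e\<in>words n. \<Sum>e'\<in>words n. of_bool (bxor e e' \<in> ?T) * correct a b e e')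
       \<le> 2 powr real n * card ?T" .
  qed
  also have "\<dots> \<le> (\<Sum>b\<in>{1..MB}. 2 powr real n * 2 powr (real n * (Hb ?r + \<delta>)))"
    by (intro sum_mono mult_left_mono card_typical_le r) simp
  finally show ?thesis
    by (simp add: K_def powr_add[symmetric] algebra_simps)
qed

end

section \<open>Numbers of messages and comparison of rates\<close>

lemma num_msgs_pos: "0 \<le> R \<Longrightarrow> 0 < num_msgs n R"
  unfolding num_msgs_def by (simp add: ge_one_powr_ge_zero)

lemma num_msgs_le: "real (num_msgs n R) \<le> 2 powr (real n * R)"
  unfolding num_msgs_def by simp

text \<open>At nonnegative rate there is at least one message, so rounding down loses a factor of at
  most 2.\<close>

lemma num_msgs_ge:
  assumes "0 \<le> R"
  shows "2 powr (real n * R) \<le> 2 * real (num_msgs n R)"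
proof -
  have "1 \<le> num_msgs n R"
    using num_msgs_pos[OF assms, of n] by simp
  moreover have "2 powr (real n * R) \<le> real (num_msgs n R) + 1"
    unfolding num_msgs_def by linarith
  ultimately show ?thesis by simp
qed

text \<open>The slack 3 * \<delta> is the largest among the counting bounds. With \<delta> = (R - c)
  / 6 the rate exceeds c + 3 * \<delta> by another 3 * \<delta>, and the resulting exponential
  overtakes \<open>K\<close>.\<close>

lemma rate_le_of_eventually:
  assumes "\<And>\<delta>. 0 < \<delta> \<Longrightarrow> \<forall>\<^sub>F n in sequentially. 2 powr (real n * R) \<le> K * 2 powr (real n * (c + 3 * \<delta>))"
  shows "R \<le> c"
proof (rule ccontr)
  assume "\<not> R \<le> c"
  define \<delta> where "\<delta> = (R - c) / 6"
  have \<delta>: "0 < \<delta>" "R = c + 3 * \<delta> + 3 * \<delta>"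
    using \<open>\<not> R \<le> c\<close> by (auto simp: \<delta>_def field_simps)
  have "filterlim (\<lambda>n. (2 powr (3 * \<delta>)) ^ n) at_top sequentially"
    by (rule filterlim_at_infinity_imp_filterlim_at_top[OF filterlim_realpow_sequentially_gt1])
      (use \<delta> in simp_all)
  then have "\<forall>\<^sub>F n in sequentially. K < (2 powr (3 * \<delta>)) ^ n"
    by (simp add: filterlim_at_top_dense)
  with assms[OF \<delta>(1)] have "\<forall>\<^sub>F n in sequentially. False"
  proof eventually_elim
    case (elim n)
    have "2 powr (real n * R) = 2 powr (real n * (c + 3 * \<delta>)) * (2 powr (3 * \<delta>)) ^ n"
      by (subst \<delta>(2)) (simp add: powr_add[symmetric] powr_realpow[symmetric] powr_powr algebra_simps)
    with elim(1) have "(2 powr (3 * \<delta>)) ^ n \<le> K"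
      by (simp add: mult.commute)
    with elim(2) show False by simp
  qed
  then show False by simp
qed

definition joint_region :: "real \<Rightarrow> real \<Rightarrow> (real \<times> real) set" where
  "joint_region p q = {(RA, RB). 0 \<le> RA \<and> 0 \<le> RB \<and>
     RA \<le> bsc_cap p + bsc_cap q - bsc_cap (bsc_compose p q) \<and> RB \<le> bsc_cap q \<and>
     RA + RB \<le> bsc_cap p + bsc_cap q}"

lemma joint_achievable_in_region:
  fixes p13 p23 p34 :: real
  defines "q \<equiv> bsc_compose (bsc_compose p13 p23) p34"
  assumes p: "0 \<le> p14" "p14 \<le> 1" and q: "0 \<le> q" "q \<le> 1"
    and ach: "joint_achievable p13 p14 p23 p34 (RA, RB)"
  shows "(RA, RB) \<in> joint_region p14 q"
proof -
  let ?r = "bsc_compose p14 q"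
  have r: "0 \<le> ?r" "?r \<le> 1"
    using bsc_compose_bounds[OF p q] by auto
  have R: "0 \<le> RA" "0 \<le> RB"
    using ach by (auto simp: joint_achievable_def)
  define A B where "A n = num_msgs n RA" and "B n = num_msgs n RB" for n
  have AB: "0 < A n" "0 < B n" "2 powr (real n * RA) \<le> 2 * A n" "2 powr (real n * RB) \<le> 2 * B n" for n
    using R by (simp_all add: A_def B_def num_msgs_pos num_msgs_ge)
  \<comment> \<open>A factor 2 comes from \<open>half\<close> and a factor 2 from the rounding of
    each message count: 4 for a single rate, 8 for the sum.\<close>
  have bounds: "\<forall>\<^sub>F n in sequentially.
        2 powr (real n * RA) \<le> 4 * 2 powr (real n * (1 + Hb ?r - Hb p14 - Hb q + 3 * \<delta>)) \<and>
        2 powr (real n * RB) \<le> 4 * 2 powr (real n * (1 - Hb q + 3 * \<delta>)) \<and>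
        2 powr (real n * (RA + RB)) \<le> 8 * 2 powr (real n * (2 - Hb p14 - Hb q + 3 * \<delta>))"
    if \<delta>: "0 < \<delta>" for \<delta>
  proof -
    \<comment> \<open>At most three atypical probabilities occur in one bound; together they stay
      below 1/4, which leaves at least 1/2 of the success probability 3/4.\<close>
    have small: "\<forall>\<^sub>F n in sequentially. atypical_prob s \<delta> n < 1 / 12" if "0 \<le> s" "s \<le> 1" for s
      using tendsto_atypical_prob[OF that \<delta>] by (rule order_tendstoD) simp
    have "\<forall>\<^sub>F n in sequentially. \<exists>f g d.
        (\<forall>a\<in>{1..A n}. length (f a) = n) \<and> (\<forall>b\<in>{1..B n}. length (g b) = n) \<and>
        joint_err p13 p14 p23 p34 n (A n) (B n) f g d \<le> 1 / 4"
      using ach[unfolded joint_achievable_def, THEN conjunct2, THEN conjunct2, rule_format, of "1 / 4"]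
      unfolding eventually_sequentially A_def B_def fst_conv snd_conv by simp
    then show ?thesis
      using small[OF p] small[OF q] small[OF r]
    proof eventually_elim
      case (elim n)
      then obtain f g d where fg: "\<forall>a\<in>{1..A n}. length (f a) = n" "\<forall>b\<in>{1..B n}. length (g b) = n"
        and err: "joint_err p13 p14 p23 p34 n (A n) (B n) f g d \<le> 1 / 4"
        by blast
      have f: "f a \<in> words n" if "a \<in> {1..A n}" for a
        using fg(1) that by (simp add: words_def)
      have g: "g b \<in> words n" if "b \<in> {1..B n}" for b
        using fg(2) that by (simp add: words_def)
      have S: "3 / 4 * (real (A n) * real (B n)) \<le> success_sum p14 q n (A n) (B n) f g d"
        unfolding q_def joint_err_success_sum[OF AB(1,2)] using err
        by (intro mult_right_mono) auto
      have noise: "real (A n) * real (B n) * x \<le> real (A n) * real (B n) * (1 / 4)" if "x \<le> 1 / 4" for x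
        using that by (intro mult_left_mono) auto
      have half: "real (A n) * real (B n) \<le> 2 * K" if
        "success_sum p14 q n (A n) (B n) f g d \<le> K + real (A n) * real (B n) * x" "x \<le> 1 / 4" for K x
        using S that(1) noise[OF that(2)] by linarith
      note ctxt = p q f g
      have "real (A n) * real (B n) \<le> 2 * (real (B n) * 2 powr (real n * (1 + Hb ?r - Hb p14 - Hb q + 3 * \<delta>)))"
        by (rule half[OF success_sum_le_A[OF ctxt]]) (use elim in auto)
      then have "real (A n) \<le> 2 * 2 powr (real n * (1 + Hb ?r - Hb p14 - Hb q + 3 * \<delta>))"
        using AB(2)[of n] by simp
      moreover have "real (A n) * real (B n) \<le> 2 * (real (A n) * 2 powr (real n * (1 - Hb q + \<delta>)))"
        by (rule half[OF success_sum_le_B[OF ctxt]]) (use elim in auto)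
      then have "real (B n) \<le> 2 * 2 powr (real n * (1 - Hb q + \<delta>))"
        using AB(1)[of n] by simp
      then have "real (B n) \<le> 2 * 2 powr (real n * (1 - Hb q + 3 * \<delta>))"
        using \<delta> by (elim order_trans) (simp add: mult_left_mono)
      moreover have "real (A n) * real (B n) \<le> 2 * 2 powr (real n * (2 - Hb p14 - Hb q + 2 * \<delta>))"
        by (rule half[OF success_sum_le_total[OF ctxt]]) (use elim in auto)
      then have "real (A n) * real (B n) \<le> 2 * 2 powr (real n * (2 - Hb p14 - Hb q + 3 * \<delta>))"
        using \<delta> by (elim order_trans) (simp add: mult_left_mono)
      moreover have "2 powr (real n * (RA + RB)) \<le> (2 * real (A n)) * (2 * real (B n))"
        unfolding distrib_left powr_add using AB(3,4)[of n] by (intro mult_mono) auto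
      ultimately show ?case
        using AB(3,4)[of n] by auto
    qed
  qed
  have "RA \<le> 1 + Hb ?r - Hb p14 - Hb q"
    by (intro rate_le_of_eventually[of _ 4], rule eventually_mono[OF bounds]) auto
  moreover have "RB \<le> 1 - Hb q"
    by (intro rate_le_of_eventually[of _ 4], rule eventually_mono[OF bounds]) auto
  moreover have "RA + RB \<le> 2 - Hb p14 - Hb q"
    by (intro rate_le_of_eventually[of _ 8], rule eventually_mono[OF bounds]) auto
  ultimately show ?thesis
    using R by (simp add: joint_region_def bsc_cap_def)
qed

section \<open>Random coding\<close>

text \<open>Drawing one codeword afresh preserves the uniform distribution on codebooks. On the
  right the old entry at \<open>a\<close> is overwritten, so each resampled codebook is counted
  \<open>card W\<close> times.\<close>

lemma sum_PiE_resample: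
  fixes \<phi> :: "('a \<Rightarrow> 'b) \<Rightarrow> real"
  assumes a: "a \<in> A"
  shows "real (card W) * (\<Sum>f\<in>PiE A (\<lambda>_. W). \<phi> f) = (\<Sum>f\<in>PiE A (\<lambda>_. W). \<Sum>x\<in>W. \<phi> (f(a := x)))"
proof -
  let ?A = "A - {a}"
  have A: "insert a ?A = A"
    using a by auto
  have inj: "inj_on (\<lambda>(y, g). g(a := y)) (W \<times> PiE ?A (\<lambda>_. W))"
    by (rule inj_combinator) simp
  have split: "(\<Sum>f\<in>PiE A (\<lambda>_. W). \<psi> f) = (\<Sum>(y, g)\<in>W \<times> PiE ?A (\<lambda>_. W). \<psi> (g(a := y)))"
    for \<psi> :: "('a \<Rightarrow> 'b) \<Rightarrow> real"
    using PiE_insert_eq[of a ?A "\<lambda>_. W"] unfolding A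
    by (simp add: split_def sum.reindex[OF inj[unfolded split_def]])
  show ?thesis
    unfolding split
    by (simp add: sum.cartesian_product[symmetric] sum_distrib_left[symmetric])
      (subst sum.swap, simp)
qed

lemma exists_le_average:
  fixes \<phi> :: "'a \<Rightarrow> real"
  assumes "finite S" "S \<noteq> {}" "(\<Sum>x\<in>S. \<phi> x) \<le> real (card S) * B"
  obtains x where "x \<in> S" "\<phi> x \<le> B"
proof (rule ccontr)
  assume "\<not> thesis"
  with that have "\<And>x. x \<in> S \<Longrightarrow> B < \<phi> x"
    by force
  then have "(\<Sum>x\<in>S. B) < (\<Sum>x\<in>S. \<phi> x)"
    using assms by (intro sum_strict_mono) auto
  with assms show False by simp
qed

section \<open>Typicality decoding of both messages\<close>

context
  fixes p q \<delta> :: real and n :: nat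
  assumes p: "0 \<le> p" "p \<le> 1" and q: "0 \<le> q" "q \<le> 1"
begin

text \<open>Besides the two noise words, their sum is required to be typical; it is known to the decoder
  from the guess for the message of node 2 alone, because the codeword of node 1 cancels.\<close>

definition jointly_typical :: "bool list \<Rightarrow> bool list \<Rightarrow> bool" where
  "jointly_typical e e' \<longleftrightarrow> e \<in> typical p \<delta> n \<and> e' \<in> typical q \<delta> n
     \<and> bxor e e' \<in> typical (bsc_compose p q) \<delta> n"

text \<open>The arguments of \<open>jointly_typical\<close> are the noise words that would have
  produced \<open>u\<close> and \<open>v\<close> from the codewords \<open>x\<close> and
  \<open>y\<close>.\<close>

definition consistent ::
  "bool list \<Rightarrow> bool list \<Rightarrow> bool list \<Rightarrow> bool list \<Rightarrow> bool" where
  "consistent x y u v \<longleftrightarrow> jointly_typical (bxor x u) (bxor (bxor x y) v)"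

definition noise_mean :: "(bool list \<Rightarrow> bool list \<Rightarrow> real) \<Rightarrow> real" where
  "noise_mean F = (\<Sum>e\<in>words n. \<Sum>e'\<in>words n. err_prob p e * err_prob q e' * F e e')"

lemma noise_mean_mono:
  assumes "\<And>e e'. e \<in> words n \<Longrightarrow> e' \<in> words n \<Longrightarrow> F e e' \<le> G e e'"
  shows "noise_mean F \<le> noise_mean G"
  unfolding noise_mean_def
  by (intro sum_mono mult_left_mono assms mult_nonneg_nonneg err_prob_nonneg p q)

lemma noise_mean_const: "noise_mean (\<lambda>_ _. c) = c"
  by (simp add: noise_mean_def sum_distrib_left[symmetric] sum_distrib_right[symmetric] sum_err_prob)

lemma noise_mean_add: "noise_mean (\<lambda>e e'. F e e' + G e e') = noise_mean F + noise_mean G"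
  by (simp add: noise_mean_def distrib_left sum.distrib)

lemma noise_mean_sum: "noise_mean (\<lambda>e e'. \<Sum>x\<in>X. F x e e') = (\<Sum>x\<in>X. noise_mean (F x))"
proof (induction X rule: infinite_finite_induct)
  case (insert x X)
  then show ?case by (simp add: noise_mean_add)
qed (simp_all add: noise_mean_const)

lemma noise_mean_cong:
  assumes "\<And>e e'. e \<in> words n \<Longrightarrow> e' \<in> words n \<Longrightarrow> F e e' = G e e'"
  shows "noise_mean F = noise_mean G"
  unfolding noise_mean_def by (intro sum.cong refl arg_cong2[where f = "(*)"] assms)

lemma noise_mean_not_jointly_typical:
  "noise_mean (\<lambda>e e'. of_bool (\<not> jointly_typical e e'))
   \<le> atypical_prob p \<delta> n + atypical_prob q \<delta> n + atypical_prob (bsc_compose p q) \<delta> n"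
proof -
  have "noise_mean (\<lambda>e e'. of_bool (\<not> jointly_typical e e')) \<le>
     noise_mean (\<lambda>e e'. of_bool (e \<notin> typical p \<delta> n) + of_bool (e' \<notin> typical q \<delta> n)
       + of_bool (bxor e e' \<notin> typical (bsc_compose p q) \<delta> n))"
    by (intro noise_mean_mono) (auto simp: jointly_typical_def)
  then show ?thesis
    unfolding noise_mean_add
    unfolding noise_mean_def noise_sum_fst noise_sum_snd
      sum_err_prob_bxor[where F = "\<lambda>s. of_bool (s \<notin> typical (bsc_compose p q) \<delta> n)"]
      atypical_prob_def .
qed

lemma sum_typical_of_bool: "(\<Sum>e\<in>words n. of_bool (e \<in> typical s \<delta> n)) = real (card (typical s \<delta> n))"
  by (simp add: sum_of_bool_eq Int_absorb1[OF typical_subset_words])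

lemma sum_typical_translate:
  assumes "x \<in> words n"
  shows "(\<Sum>e\<in>words n. of_bool (bxor x e \<in> typical s \<delta> n)) = real (card (typical s \<delta> n))"
  by (subst sum_words_bxor[OF assms]) (rule sum_typical_of_bool)

text \<open>The two candidate noise words run independently through all words: \<open>x\<close>
  alone determines the first, and for each \<open>x\<close> the second is a translate of
  \<open>y\<close>.\<close>

lemma sum_consistent_both:
  assumes u: "u \<in> words n" and v: "v \<in> words n"
  shows "(\<Sum>x\<in>words n. \<Sum>y\<in>words n. of_bool (consistent x y u v))
    \<le> real (card (typical p \<delta> n)) * real (card (typical q \<delta> n))"
proof -
  have "(\<Sum>x\<in>words n. \<Sum>y\<in>words n. of_bool (consistent x y u v))
     \<le> (\<Sum>x\<in>words n. \<Sum>y\<in>words n. of_bool (bxor u x \<in> typical p \<delta> n) *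
          (of_bool (bxor (bxor x v) y \<in> typical q \<delta> n) :: real))"
    by (intro sum_mono) (auto simp: consistent_def jointly_typical_def bxor_ac)
  also have "\<dots> = (\<Sum>x\<in>words n. of_bool (bxor u x \<in> typical p \<delta> n) * real (card (typical q \<delta> n)))"
    by (intro sum.cong refl)
      (simp add: sum_distrib_left[symmetric] sum_typical_translate[OF bxor_in_words[OF _ v]])
  also have "\<dots> = real (card (typical p \<delta> n)) * real (card (typical q \<delta> n))"
    by (simp add: sum_distrib_right[symmetric] sum_typical_translate[OF u])
  finally show ?thesis .
qed

lemma sum_consistent_snd:
  assumes "x \<in> words n" and "v \<in> words n"
  shows "(\<Sum>y\<in>words n. of_bool (consistent x y u v)) \<le> real (card (typical q \<delta> n))"
proof -
  have "(\<Sum>y\<in>words n. of_bool (consistent x y u v))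
     \<le> (\<Sum>y\<in>words n. (of_bool (bxor (bxor x v) y \<in> typical q \<delta> n) :: real))"
    by (intro sum_mono) (auto simp: consistent_def jointly_typical_def bxor_ac)
  also have "\<dots> = real (card (typical q \<delta> n))"
    by (rule sum_typical_translate[OF bxor_in_words[OF assms]])
  finally show ?thesis .
qed

text \<open>If only the codeword of node 1 is resampled, the sum of the noise words is unaffected. Its
  probability is at most \<open>2 powr (- n * (Hb p'' - \<delta>))\<close>, and given this sum there are on average few
  translates putting both noise words into their typical sets.\<close>

lemma noise_mean_consistent_fst:
  assumes x: "x \<in> words n" and y: "y \<in> words n"
  shows "noise_mean (\<lambda>e e'. \<Sum>x'\<in>words n. of_bool (consistent x' y (bxor x e) (bxor x (bxor y e'))))
    \<le> 2 powr (- real n * (Hb (bsc_compose p q) - \<delta>)) *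
       (real (card (typical p \<delta> n)) * real (card (typical q \<delta> n)))"
proof -
  define r K where "r = bsc_compose p q" and "K = 2 powr (- real n * (Hb r - \<delta>))"
  \<comment> \<open>\<open>s\<close> is the sum of the true noise words and \<open>z\<close> the
    candidate first noise word \<open>bxor (bxor x e) x'\<close>. As the message of node 2 is
    guessed correctly, \<open>s\<close> is also the sum of the candidates, so the second candidate
    is \<open>bxor z s\<close>.\<close>
  define G where "G s = (\<Sum>z\<in>words n. of_bool (z \<in> typical p \<delta> n) *
      (of_bool (bxor z s \<in> typical q \<delta> n) * of_bool (s \<in> typical r \<delta> n)) :: real)" for s
  have "noise_mean (\<lambda>e e'. \<Sum>x'\<in>words n. of_bool (consistent x' y (bxor x e) (bxor x (bxor y e'))))
      = noise_mean (\<lambda>e e'. G (bxor e e'))"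
  proof (rule noise_mean_cong)
    fix e e' assume e: "e \<in> words n" and e': "e' \<in> words n"
    have "(\<Sum>x'\<in>words n. of_bool (consistent x' y (bxor x e) (bxor x (bxor y e'))) :: real)
      = (\<Sum>x'\<in>words n. of_bool (bxor (bxor x e) x' \<in> typical p \<delta> n) *
          (of_bool (bxor (bxor (bxor x e) x') (bxor e e') \<in> typical q \<delta> n) * of_bool (bxor e e' \<in> typical r \<delta> n)))"
    proof (rule sum.cong[OF refl])
      fix x' assume x': "x' \<in> words n"
      have 1: "bxor (bxor x' y) (bxor x (bxor y e')) = bxor (bxor (bxor x e) x') (bxor e e')"
      proof -
        have "bxor (bxor x' y) (bxor x (bxor y e')) = bxor y (bxor y (bxor x' (bxor x e')))"
          by (simp only: bxor_ac)
        also have "\<dots> = bxor x' (bxor x e')"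
          by (intro bxor_words_cancel[where n = n] bxor_in_words x x' y e')
        also have "\<dots> = bxor e (bxor e (bxor x' (bxor x e')))"
          by (intro bxor_words_cancel[where n = n, symmetric] bxor_in_words x x' y e' e)
        also have "\<dots> = bxor (bxor (bxor x e) x') (bxor e e')"
          by (simp only: bxor_ac)
        finally show ?thesis .
      qed
      have 2: "bxor (bxor x' (bxor x e)) (bxor (bxor (bxor x e) x') (bxor e e')) = bxor e e'"
      proof -
        have "bxor (bxor x' (bxor x e)) (bxor (bxor (bxor x e) x') (bxor e e'))
          = bxor (bxor x' (bxor x e)) (bxor (bxor x' (bxor x e)) (bxor e e'))"
          by (simp only: bxor_ac)
        also have "\<dots> = bxor e e'"
          by (intro bxor_words_cancel[where n = n] bxor_in_words x x' e e')
        finally show ?thesis .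
      qed
      show "of_bool (consistent x' y (bxor x e) (bxor x (bxor y e'))) =
         of_bool (bxor (bxor x e) x' \<in> typical p \<delta> n) *
          (of_bool (bxor (bxor (bxor x e) x') (bxor e e') \<in> typical q \<delta> n) * (of_bool (bxor e e' \<in> typical r \<delta> n) :: real))"
        unfolding consistent_def jointly_typical_def 1 2 r_def
        by (simp add: bxor_commute[of x'])
    qed
    also have "\<dots> = G (bxor e e')"
      unfolding G_def by (rule sum_words_bxor[OF bxor_in_words[OF x e]])
    finally show "(\<Sum>x'\<in>words n. of_bool (consistent x' y (bxor x e) (bxor x (bxor y e')))) = G (bxor e e')" .
  qed
  also have "\<dots> = (\<Sum>s\<in>words n. err_prob r s * G s)"
    unfolding noise_mean_def r_def by (rule sum_err_prob_bxor)
  \<comment> \<open>Typicality of \<open>s\<close> is spent on bounding its probability by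
    \<open>K\<close>. The sum over \<open>s\<close> for fixed \<open>z\<close> then counts a
    translate of the second typical set, which makes the double sum a product of
    cardinalities.\<close>
  also have "\<dots> \<le> (\<Sum>s\<in>words n. K * (\<Sum>z\<in>words n. of_bool (z \<in> typical p \<delta> n) * of_bool (bxor z s \<in> typical q \<delta> n)))"
  proof (rule sum_mono)
    fix s
    show "err_prob r s * G s \<le> K * (\<Sum>z\<in>words n. of_bool (z \<in> typical p \<delta> n) * of_bool (bxor z s \<in> typical q \<delta> n))"
    proof (cases "s \<in> typical r \<delta> n")
      case True
      then have "err_prob r s \<le> K"
        unfolding K_def by (rule err_prob_typical_le)
      with True show ?thesis
        unfolding G_def by (auto intro!: mult_right_mono sum_nonneg)
    qed (simp add: G_def K_def sum_nonneg)
  qed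
  also have "\<dots> = K * (\<Sum>z\<in>words n. of_bool (z \<in> typical p \<delta> n) * (\<Sum>s\<in>words n. of_bool (bxor z s \<in> typical q \<delta> n)))"
    unfolding sum_distrib_left[of K, symmetric] by (subst sum.swap) (simp add: sum_distrib_left)
  also have "(\<Sum>z\<in>words n. of_bool (z \<in> typical p \<delta> n) * (\<Sum>s\<in>words n. of_bool (bxor z s \<in> typical q \<delta> n)))
     = real (card (typical p \<delta> n)) * real (card (typical q \<delta> n))"
    by (simp add: sum_typical_translate sum_typical_of_bool sum_distrib_right[symmetric])
  finally show ?thesis
    by (simp add: K_def r_def)
qed

text \<open>Any consistent pair will do. If there is none, \<open>SOME\<close> returns an
  unspecified value; the transmitted pair is then inconsistent too, and the event is charged to
  noise that is not jointly typical.\<close>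

definition typical_decoder ::
  "nat \<Rightarrow> nat \<Rightarrow> (nat \<Rightarrow> bool list) \<Rightarrow> (nat \<Rightarrow> bool list) \<Rightarrow> bool list \<Rightarrow> bool list \<Rightarrow> nat \<times> nat" where
  "typical_decoder MA MB f g u v =
     (SOME m. m \<in> {1..MA} \<times> {1..MB} \<and> consistent (f (fst m)) (g (snd m)) u v)"

text \<open>Union bound: the transmitted pair passes the test exactly when the noise is jointly
  typical, so under such noise a wrong answer is a wrong pair that passes. The sums separate an
  error in the first message, in the second, or in both.\<close>

lemma typical_decoder_error:
  assumes ab: "a \<in> {1..MA}" "b \<in> {1..MB}"
    and fg: "f a \<in> words n" "g b \<in> words n" and ee: "e \<in> words n" "e' \<in> words n"
  defines "u \<equiv> bxor (f a) e" and "v \<equiv> bxor (f a) (bxor (g b) e')"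
  shows "of_bool (typical_decoder MA MB f g u v \<noteq> (a, b)) \<le>
     of_bool (\<not> jointly_typical e e') +
     ((\<Sum>a'\<in>{1..MA} - {a}. of_bool (consistent (f a') (g b) u v)) +
     ((\<Sum>b'\<in>{1..MB} - {b}. of_bool (consistent (f a) (g b') u v)) +
     (\<Sum>a'\<in>{1..MA} - {a}. \<Sum>b'\<in>{1..MB} - {b}. of_bool (consistent (f a') (g b') u v) :: real)))"
    (is "?L \<le> ?T + (?SA + (?SB + ?SAB))")
proof -
  have nonneg: "0 \<le> ?T" "0 \<le> ?SA" "0 \<le> ?SB" "0 \<le> ?SAB"
    by (simp_all add: sum_nonneg)
  have self: "consistent (f a) (g b) u v \<longleftrightarrow> jointly_typical e e'"
    using fg ee bxor_words_cancel[OF bxor_in_words[OF fg], of e']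
    by (simp add: consistent_def u_def v_def bxor_words_cancel bxor_assoc)
  define m where "m = typical_decoder MA MB f g u v"
  show ?thesis
  proof (cases "m = (a, b) \<or> \<not> jointly_typical e e'")
    case True
    then show ?thesis
      using nonneg by (auto simp: m_def[symmetric])
  next
    case False
    have m: "m \<in> {1..MA} \<times> {1..MB} \<and> consistent (f (fst m)) (g (snd m)) u v"
      unfolding m_def typical_decoder_def
      by (rule someI[of _ "(a, b)"]) (use ab False self in simp)
    obtain a' b' where ab': "m = (a', b')" by (cases m)
    have mem: "a' \<in> {1..MA}" "b' \<in> {1..MB}" "consistent (f a') (g b') u v" "(a', b') \<noteq> (a, b)"
      using m ab' False by auto
    consider "a' \<noteq> a" "b' = b" | "a' = a" "b' \<noteq> b" | "a' \<noteq> a" "b' \<noteq> b"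
      using mem(4) by auto
    then have "1 \<le> ?SA + (?SB + ?SAB)"
    proof cases
      case 1
      then have "of_bool (consistent (f a') (g b) u v) \<le> ?SA"
        using mem by (intro member_le_sum) auto
      with 1 mem nonneg show ?thesis by simp
    next
      case 2
      then have "of_bool (consistent (f a) (g b') u v) \<le> ?SB"
        using mem by (intro member_le_sum) auto
      with 2 mem nonneg show ?thesis by simp
    next
      case 3
      then have "of_bool (consistent (f a') (g b') u v) \<le>
          (\<Sum>b'\<in>{1..MB} - {b}. of_bool (consistent (f a') (g b') u v) :: real)"
        using mem by (intro member_le_sum) auto
      also have "\<dots> \<le> ?SAB"
        using 3 mem by (intro member_le_sum) (auto simp: sum_nonneg)
      finally show ?thesis
        using 3 mem nonneg by simp
    qed
    with nonneg show ?thesis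
      by (auto simp: of_bool_def)
  qed
qed

text \<open>With all other codewords fixed, a bound \<open>C\<close> on the sum over the values of
  one codeword becomes a bound C / 2^n on its average.\<close>

lemma sum_PiE_le_resample:
  fixes \<phi> :: "(nat \<Rightarrow> bool list) \<Rightarrow> real"
  assumes "a \<in> A" and "\<And>f. f \<in> PiE A (\<lambda>_. words n) \<Longrightarrow> (\<Sum>x\<in>words n. \<phi> (f(a := x))) \<le> C"
  shows "(\<Sum>f\<in>PiE A (\<lambda>_. words n). \<phi> f) \<le> real (card (PiE A (\<lambda>_. words n))) * (C / 2 ^ n)"
proof -
  have "2 ^ n * (\<Sum>f\<in>PiE A (\<lambda>_. words n). \<phi> f)
      = (\<Sum>f\<in>PiE A (\<lambda>_. words n). \<Sum>x\<in>words n. \<phi> (f(a := x)))"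
    using sum_PiE_resample[OF assms(1), of "words n" \<phi>] by (simp add: card_words)
  also have "\<dots> \<le> (\<Sum>f\<in>PiE A (\<lambda>_. words n). C)"
    by (intro sum_mono assms(2))
  finally show ?thesis
    by (simp add: field_simps)
qed

lemma noise_mean_le_const:
  assumes "\<And>e e'. e \<in> words n \<Longrightarrow> e' \<in> words n \<Longrightarrow> F e e' \<le> c"
  shows "noise_mean F \<le> c"
  using noise_mean_mono[of F "\<lambda>_ _. c"] assms by (simp add: noise_mean_const)

section \<open>Expected confusion over random codebooks\<close>

abbreviation "codebooks M \<equiv> PiE {1..M} (\<lambda>_. words n)"

definition confusion ::
  "(nat \<Rightarrow> bool list) \<Rightarrow> (nat \<Rightarrow> bool list) \<Rightarrow> nat \<Rightarrow> nat \<Rightarrow> nat \<Rightarrow> nat \<Rightarrow> real" where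
  "confusion f g a b a' b' = noise_mean (\<lambda>e e'.
     of_bool (consistent (f a') (g b') (bxor (f a) e) (bxor (f a) (bxor (g b) e'))))"

text \<open>Union bound for one message pair: atypical noise, then wrong pairs differing in the
  first, the second, or both messages. Each resampled codeword contributes a factor 1 / 2 ^
  n.\<close>

definition random_coding_bound :: "nat \<Rightarrow> nat \<Rightarrow> real" where
  "random_coding_bound MA MB =
     atypical_prob p \<delta> n + atypical_prob q \<delta> n + atypical_prob (bsc_compose p q) \<delta> n +
     (real (MA - 1) * (2 powr (- real n * (Hb (bsc_compose p q) - \<delta>)) *
         (real (card (typical p \<delta> n)) * real (card (typical q \<delta> n))) / 2 ^ n) +
     (real (MB - 1) * (real (card (typical q \<delta> n)) / 2 ^ n) +
     real (MA - 1) * (real (MB - 1) *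
         (real (card (typical p \<delta> n)) * real (card (typical q \<delta> n)) / 2 ^ n / 2 ^ n))))"

text \<open>Resampling the codeword of the wrong message \<open>a'\<close> leaves the transmitted
  codeword and the noise alone, so \<open>noise_mean_consistent_fst\<close> applies. The second
  codebook may be frozen to a constant, since only the codeword of \<open>b\<close> enters.\<close>

lemma sum_confusion_fst:
  assumes "a \<in> {1..MA}" "a' \<in> {1..MA}" "a' \<noteq> a" "y \<in> words n"
  shows "(\<Sum>f\<in>codebooks MA. confusion f (\<lambda>_. y) a b a' b) \<le> real (card (codebooks MA)) *
    (2 powr (- real n * (Hb (bsc_compose p q) - \<delta>)) *
         (real (card (typical p \<delta> n)) * real (card (typical q \<delta> n))) / 2 ^ n)"
proof (rule sum_PiE_le_resample[OF assms(2)])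
  fix f assume "f \<in> codebooks MA"
  then have "f a \<in> words n"
    using assms by auto
  from noise_mean_consistent_fst[OF this assms(4)]
  show "(\<Sum>x\<in>words n. confusion (f(a' := x)) (\<lambda>_. y) a b a' b) \<le>
    2 powr (- real n * (Hb (bsc_compose p q) - \<delta>)) *
         (real (card (typical p \<delta> n)) * real (card (typical q \<delta> n)))"
    using assms(3) by (simp add: confusion_def noise_mean_sum)
qed

lemma sum_confusion_snd:
  assumes "b \<in> {1..MB}" "b' \<in> {1..MB}" "b' \<noteq> b" "f a \<in> words n"
  shows "(\<Sum>g\<in>codebooks MB. confusion f g a b a b') \<le>
    real (card (codebooks MB)) * (real (card (typical q \<delta> n)) / 2 ^ n)"
proof (rule sum_PiE_le_resample[OF assms(2)])
  fix g assume "g \<in> codebooks MB"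
  then have "g b \<in> words n"
    using assms by auto
  then have "noise_mean (\<lambda>e e'. \<Sum>y\<in>words n.
      of_bool (consistent (f a) y (bxor (f a) e) (bxor (f a) (bxor (g b) e')))) \<le> real (card (typical q \<delta> n))"
    by (intro noise_mean_le_const sum_consistent_snd bxor_in_words assms)
  then show "(\<Sum>y\<in>words n. confusion f (g(b' := y)) a b a b') \<le> real (card (typical q \<delta> n))"
    using assms(3) by (simp add: confusion_def noise_mean_sum)
qed

lemma sum_confusion_both:
  assumes "a \<in> {1..MA}" "a' \<in> {1..MA}" "a' \<noteq> a" and "b \<in> {1..MB}" "b' \<in> {1..MB}" "b' \<noteq> b"
  shows "(\<Sum>f\<in>codebooks MA. \<Sum>g\<in>codebooks MB. confusion f g a b a' b') \<le>
    real (card (codebooks MA)) * (real (card (codebooks MB)) *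
      (real (card (typical p \<delta> n)) * real (card (typical q \<delta> n)) / 2 ^ n / 2 ^ n))"
proof -
  have "(\<Sum>x\<in>words n. \<Sum>g\<in>codebooks MB. confusion (f(a' := x)) g a b a' b')
     \<le> real (card (codebooks MB)) *
        (real (card (typical p \<delta> n)) * real (card (typical q \<delta> n)) / 2 ^ n)"
    if f: "f \<in> codebooks MA" for f
  proof (subst sum.swap, rule sum_PiE_le_resample[OF assms(5)])
    fix g assume "g \<in> codebooks MB"
    then have "f a \<in> words n" "g b \<in> words n"
      using assms f by auto
    then have "noise_mean (\<lambda>e e'. \<Sum>x\<in>words n. \<Sum>y\<in>words n.
        of_bool (consistent x y (bxor (f a) e) (bxor (f a) (bxor (g b) e'))))
        \<le> real (card (typical p \<delta> n)) * real (card (typical q \<delta> n))"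
      by (intro noise_mean_le_const sum_consistent_both bxor_in_words)
    then have "(\<Sum>x\<in>words n. \<Sum>y\<in>words n. confusion (f(a' := x)) (g(b' := y)) a b a' b')
        \<le> real (card (typical p \<delta> n)) * real (card (typical q \<delta> n))"
      using assms(3,6) by (simp add: confusion_def noise_mean_sum)
    then show "(\<Sum>y\<in>words n. \<Sum>x\<in>words n. confusion (f(a' := x)) (g(b' := y)) a b a' b')
        \<le> real (card (typical p \<delta> n)) * real (card (typical q \<delta> n))"
      by (subst sum.swap)
  qed
  from sum_PiE_le_resample[OF assms(2) this] show ?thesis
    by simp
qed

lemma random_coding:
  assumes "a \<in> {1..MA}" "b \<in> {1..MB}"
  shows "(\<Sum>f\<in>codebooks MA. \<Sum>g\<in>codebooks MB. noise_mean (\<lambda>e e'.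
     of_bool (typical_decoder MA MB f g (bxor (f a) e) (bxor (f a) (bxor (g b) e')) \<noteq> (a, b))))
   \<le> real (card (codebooks MA)) * (real (card (codebooks MB)) * random_coding_bound MA MB)"
    (is "?L \<le> ?F * (?G * _)")
proof -
  define \<alpha> where
    "\<alpha> = atypical_prob p \<delta> n + atypical_prob q \<delta> n + atypical_prob (bsc_compose p q) \<delta> n"
  let ?\<beta>A = "2 powr (- real n * (Hb (bsc_compose p q) - \<delta>)) *
      (real (card (typical p \<delta> n)) * real (card (typical q \<delta> n))) / 2 ^ n"
  let ?\<beta>B = "real (card (typical q \<delta> n)) / 2 ^ n"
  let ?\<beta> = "real (card (typical p \<delta> n)) * real (card (typical q \<delta> n)) / 2 ^ n / 2 ^ n"
  let ?A = "{1..MA} - {a}" and ?B = "{1..MB} - {b}"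
  have card: "card ?A = MA - 1" "card ?B = MB - 1"
    using assms by auto
  have "?L \<le> (\<Sum>f\<in>codebooks MA. \<Sum>g\<in>codebooks MB. \<alpha> + ((\<Sum>a'\<in>?A. confusion f g a b a' b) +
      ((\<Sum>b'\<in>?B. confusion f g a b a b') + (\<Sum>a'\<in>?A. \<Sum>b'\<in>?B. confusion f g a b a' b'))))"
  proof (intro sum_mono)
    fix f g assume "f \<in> codebooks MA" "g \<in> codebooks MB"
    then have "f a \<in> words n" "g b \<in> words n"
      using assms by auto
    then have "noise_mean (\<lambda>e e'.
       of_bool (typical_decoder MA MB f g (bxor (f a) e) (bxor (f a) (bxor (g b) e')) \<noteq> (a, b)))
       \<le> noise_mean (\<lambda>e e'. of_bool (\<not> jointly_typical e e') +
     ((\<Sum>a'\<in>?A. of_bool (consistent (f a') (g b) (bxor (f a) e) (bxor (f a) (bxor (g b) e')))) +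
     ((\<Sum>b'\<in>?B. of_bool (consistent (f a) (g b') (bxor (f a) e) (bxor (f a) (bxor (g b) e')))) +
     (\<Sum>a'\<in>?A. \<Sum>b'\<in>?B. of_bool (consistent (f a') (g b') (bxor (f a) e) (bxor (f a) (bxor (g b) e')))))))"
      by (intro noise_mean_mono typical_decoder_error assms)
    then show "noise_mean (\<lambda>e e'.
       of_bool (typical_decoder MA MB f g (bxor (f a) e) (bxor (f a) (bxor (g b) e')) \<noteq> (a, b)))
       \<le> \<alpha> + ((\<Sum>a'\<in>?A. confusion f g a b a' b) +
      ((\<Sum>b'\<in>?B. confusion f g a b a b') + (\<Sum>a'\<in>?A. \<Sum>b'\<in>?B. confusion f g a b a' b')))"
      using noise_mean_not_jointly_typical
      unfolding noise_mean_add noise_mean_sum confusion_def \<alpha>_def by linarith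
  qed
  also have "\<dots> = ?F * (?G * \<alpha>) + ((\<Sum>f\<in>codebooks MA. \<Sum>g\<in>codebooks MB. \<Sum>a'\<in>?A. confusion f g a b a' b) +
      ((\<Sum>f\<in>codebooks MA. \<Sum>g\<in>codebooks MB. \<Sum>b'\<in>?B. confusion f g a b a b') +
       (\<Sum>f\<in>codebooks MA. \<Sum>g\<in>codebooks MB. \<Sum>a'\<in>?A. \<Sum>b'\<in>?B. confusion f g a b a' b')))"
    by (simp only: sum.distrib sum_constant)
  also have "\<dots> \<le> ?F * (?G * \<alpha>) + (?F * (?G * (real (MA - 1) * ?\<beta>A)) +
      (?F * (?G * (real (MB - 1) * ?\<beta>B)) + ?F * (?G * (real (MA - 1) * (real (MB - 1) * ?\<beta>)))))"
  proof (intro add_mono order_refl)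
    have "(\<Sum>f\<in>codebooks MA. \<Sum>g\<in>codebooks MB. \<Sum>a'\<in>?A. confusion f g a b a' b)
      = (\<Sum>g\<in>codebooks MB. \<Sum>a'\<in>?A. \<Sum>f\<in>codebooks MA. confusion f (\<lambda>_. g b) a b a' b)"
      by (subst sum.swap, rule sum.cong[OF refl], subst sum.swap) (simp add: confusion_def)
    also have "\<dots> \<le> (\<Sum>g\<in>codebooks MB. \<Sum>a'\<in>?A. ?F * ?\<beta>A)"
      by (intro sum_mono sum_confusion_fst) (use assms in auto)
    finally show "(\<Sum>f\<in>codebooks MA. \<Sum>g\<in>codebooks MB. \<Sum>a'\<in>?A. confusion f g a b a' b)
      \<le> ?F * (?G * (real (MA - 1) * ?\<beta>A))"
      by (simp only: sum_constant card ac_simps)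
  next
    have "(\<Sum>f\<in>codebooks MA. \<Sum>g\<in>codebooks MB. \<Sum>b'\<in>?B. confusion f g a b a b')
      = (\<Sum>f\<in>codebooks MA. \<Sum>b'\<in>?B. \<Sum>g\<in>codebooks MB. confusion f g a b a b')"
      by (rule sum.cong[OF refl sum.swap])
    also have "\<dots> \<le> (\<Sum>f\<in>codebooks MA. \<Sum>b'\<in>?B. ?G * ?\<beta>B)"
      by (intro sum_mono sum_confusion_snd) (use assms in auto)
    finally show "(\<Sum>f\<in>codebooks MA. \<Sum>g\<in>codebooks MB. \<Sum>b'\<in>?B. confusion f g a b a b')
      \<le> ?F * (?G * (real (MB - 1) * ?\<beta>B))"
      by (simp only: sum_constant card ac_simps)
  next
    have "(\<Sum>f\<in>codebooks MA. \<Sum>g\<in>codebooks MB. \<Sum>a'\<in>?A. \<Sum>b'\<in>?B. confusion f g a b a' b')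
      = (\<Sum>f\<in>codebooks MA. \<Sum>a'\<in>?A. \<Sum>b'\<in>?B. \<Sum>g\<in>codebooks MB. confusion f g a b a' b')"
      by (rule sum.cong[OF refl], rule trans[OF sum.swap], rule sum.cong[OF refl sum.swap])
    also have "\<dots> = (\<Sum>a'\<in>?A. \<Sum>b'\<in>?B. \<Sum>f\<in>codebooks MA. \<Sum>g\<in>codebooks MB. confusion f g a b a' b')"
      by (rule trans[OF sum.swap], rule sum.cong[OF refl sum.swap])
    also have "\<dots> \<le> (\<Sum>a'\<in>?A. \<Sum>b'\<in>?B. ?F * (?G * ?\<beta>))"
      by (intro sum_mono sum_confusion_both) (use assms in auto)
    finally show "(\<Sum>f\<in>codebooks MA. \<Sum>g\<in>codebooks MB. \<Sum>a'\<in>?A. \<Sum>b'\<in>?B. confusion f g a b a' b')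
      \<le> ?F * (?G * (real (MA - 1) * (real (MB - 1) * ?\<beta>)))"
      by (simp only: sum_constant card ac_simps)
  qed
  also have "\<dots> = ?F * (?G * random_coding_bound MA MB)"
    unfolding random_coding_bound_def \<alpha>_def[symmetric] by (simp only: distrib_left)
  finally show ?thesis .
qed

text \<open>The bound of \<open>random_coding\<close> is the same for all message pairs, so it
  survives summation over them. Choosing after this summation yields a single pair of codebooks
  serving all messages on average.\<close>

lemma exists_good_code:
  assumes "0 < MA" "0 < MB"
  obtains f g where "\<And>a. a \<in> {1..MA} \<Longrightarrow> f a \<in> words n" "\<And>b. b \<in> {1..MB} \<Longrightarrow> g b \<in> words n"
    "(\<Sum>a\<in>{1..MA}. \<Sum>b\<in>{1..MB}. noise_mean (\<lambda>e e'.
     of_bool (typical_decoder MA MB f g (bxor (f a) e) (bxor (f a) (bxor (g b) e')) \<noteq> (a, b))))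
     \<le> real MA * real MB * random_coding_bound MA MB"
proof -
  define E where "E = (\<lambda>(f, g). \<Sum>a\<in>{1..MA}. \<Sum>b\<in>{1..MB}. noise_mean (\<lambda>e e'.
     of_bool (typical_decoder MA MB f g (bxor (f a) e) (bxor (f a) (bxor (g b) e')) \<noteq> (a, b))))"
  let ?S = "codebooks MA \<times> codebooks MB"
  have fin: "finite ?S"
    by (intro finite_cartesian_product finite_PiE) auto
  have "words n \<noteq> {}"
    using card_words[of n] by fastforce
  then have ne: "?S \<noteq> {}"
    by (simp add: PiE_eq_empty_iff)
  have "(\<Sum>x\<in>?S. E x) = (\<Sum>a\<in>{1..MA}. \<Sum>b\<in>{1..MB}. \<Sum>f\<in>codebooks MA. \<Sum>g\<in>codebooks MB.
     noise_mean (\<lambda>e e'.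
     of_bool (typical_decoder MA MB f g (bxor (f a) e) (bxor (f a) (bxor (g b) e')) \<noteq> (a, b))))"
    (is "_ = (\<Sum>a\<in>_. \<Sum>b\<in>_. \<Sum>f\<in>_. \<Sum>g\<in>_. ?N a b f g)")
  proof -
    have "(\<Sum>x\<in>?S. E x) = (\<Sum>x\<in>?S. \<Sum>a\<in>{1..MA}. \<Sum>b\<in>{1..MB}. ?N a b (fst x) (snd x))"
      by (simp add: E_def split_def)
    also have "\<dots> = (\<Sum>a\<in>{1..MA}. \<Sum>b\<in>{1..MB}. \<Sum>x\<in>?S. ?N a b (fst x) (snd x))"
      by (rule trans[OF sum.swap sum.cong[OF refl sum.swap]])
    finally show ?thesis
      by (simp add: sum.cartesian_product split_def)
  qed
  also have "\<dots> \<le> (\<Sum>a\<in>{1..MA}. \<Sum>b\<in>{1..MB}.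
     real (card (codebooks MA)) * (real (card (codebooks MB)) * random_coding_bound MA MB))"
    by (intro sum_mono random_coding)
  also have "\<dots> = real (card ?S) * (real MA * real MB * random_coding_bound MA MB)"
    by (simp add: card_cartesian_product)
  finally obtain x where "x \<in> ?S" "E x \<le> real MA * real MB * random_coding_bound MA MB"
    using exists_le_average[OF fin ne] by metis
  then show thesis
    by (intro that[of "fst x" "snd x"]) (auto simp: E_def split_def PiE_mem)
qed

end

section \<open>Exponents of the random coding bound\<close>

lemma tendsto_powr_rate:
  assumes "c < 0"
  shows "(\<lambda>n. 2 powr (real n * c)) \<longlonglongrightarrow> (0 :: real)"
proof -
  have "(\<lambda>n. (2 powr c) ^ n) \<longlonglongrightarrow> (0 :: real)"
    using powr_less_mono[OF assms, of 2] by (intro LIMSEQ_realpow_zero) auto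
  then show ?thesis
    by (simp add: powr_realpow[symmetric] powr_powr mult.commute)
qed

text \<open>At rate 0 there is a single message, so that the corresponding term of the union bound
  vanishes and the rate need not be strictly below capacity.\<close>

lemma num_msgs_diff_le:
  assumes "0 \<le> R"
  shows "real (num_msgs n R - 1) \<le> of_bool (0 < R) * 2 powr (real n * R)"
proof (cases "R = 0")
  case True
  then show ?thesis by (simp add: num_msgs_def)
next
  case False
  have "real (num_msgs n R - 1) \<le> real (num_msgs n R)"
    by simp
  also have "\<dots> \<le> 2 powr (real n * R)"
    by (rule num_msgs_le)
  finally show ?thesis
    using False assms by simp
qed

text \<open>For a wrong first message the two cardinalities and the probability bound on the noise
  sum cost one \<delta> each, hence 3 * \<delta>; the other two terms cost less and are padded to
  the same slack.\<close>

lemma tendsto_random_coding_bound: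
  fixes p q \<delta> RA RB :: real
  defines "r \<equiv> bsc_compose p q"
  assumes p: "0 \<le> p" "p \<le> 1" and q: "0 \<le> q" "q \<le> 1" and \<delta>: "0 < \<delta>" and R: "0 \<le> RA" "0 \<le> RB"
    and A: "0 < RA \<Longrightarrow> RA + 3 * \<delta> < 1 + Hb r - Hb p - Hb q"
    and B: "0 < RB \<Longrightarrow> RB + 3 * \<delta> < 1 - Hb q"
    and AB: "0 < RA \<Longrightarrow> 0 < RB \<Longrightarrow> RA + RB + 3 * \<delta> < 2 - Hb p - Hb q"
  shows "(\<lambda>n. random_coding_bound p q \<delta> n (num_msgs n RA) (num_msgs n RB)) \<longlonglongrightarrow> 0"
proof -
  have r: "0 \<le> r" "r \<le> 1"
    unfolding r_def using bsc_compose_bounds[OF p q] by auto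
  \<comment> \<open>Upper bounds for the three kinds of confusion. The indicators make a term vanish
    identically at rate zero, where no strict inequality is available to make its exponent
    negative.\<close>
  define tA tB tAB where
    "tA n = of_bool (0 < RA) * 2 powr (real n * (RA + 3 * \<delta> - (1 + Hb r - Hb p - Hb q)))" and
    "tB n = of_bool (0 < RB) * 2 powr (real n * (RB + 3 * \<delta> - (1 - Hb q)))" and
    "tAB n = of_bool (0 < RA \<and> 0 < RB) * 2 powr (real n * (RA + RB + 3 * \<delta> - (2 - Hb p - Hb q)))" for n
  define \<alpha> where "\<alpha> n = atypical_prob p \<delta> n + atypical_prob q \<delta> n + atypical_prob r \<delta> n" for n
  have lim: "tA \<longlonglongrightarrow> 0" "tB \<longlonglongrightarrow> 0" "tAB \<longlonglongrightarrow> 0"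
    unfolding tA_def tB_def tAB_def using A B AB
    by (auto simp: of_bool_def intro!: tendsto_powr_rate)
  have "\<alpha> \<longlonglongrightarrow> 0 + 0 + 0"
    unfolding \<alpha>_def by (intro tendsto_add tendsto_atypical_prob p q r \<delta>)
  with lim have "(\<lambda>n. \<alpha> n + (tA n + (tB n + tAB n))) \<longlonglongrightarrow> 0 + 0 + 0 + (0 + (0 + 0))"
    by (intro tendsto_add)
  then have lim0: "(\<lambda>n. \<alpha> n + (tA n + (tB n + tAB n))) \<longlonglongrightarrow> 0"
    by simp
  have nonneg: "0 \<le> random_coding_bound p q \<delta> n MA MB" for n MA MB
    unfolding random_coding_bound_def[OF p q] atypical_prob_def using bsc_compose_bounds[OF p q]
    by (intro add_nonneg_nonneg sum_nonneg mult_nonneg_nonneg divide_nonneg_nonneg err_prob_nonneg p q) auto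
  have "random_coding_bound p q \<delta> n (num_msgs n RA) (num_msgs n RB) \<le> \<alpha> n + (tA n + (tB n + tAB n))" for n
  proof -
    define MA MB P Q where "MA = real (num_msgs n RA - 1)" and "MB = real (num_msgs n RB - 1)"
      and "P = real (card (typical p \<delta> n))" and "Q = real (card (typical q \<delta> n))"
    have M: "MA \<le> of_bool (0 < RA) * 2 powr (real n * RA)" "MB \<le> of_bool (0 < RB) * 2 powr (real n * RB)"
      unfolding MA_def MB_def by (intro num_msgs_diff_le R)+
    have PQ: "P \<le> 2 powr (real n * (Hb p + \<delta>))" "Q \<le> 2 powr (real n * (Hb q + \<delta>))"
      unfolding P_def Q_def by (intro card_typical_le p q)+
    have pos: "0 \<le> MA" "0 \<le> MB" "0 \<le> P" "0 \<le> Q"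
      by (simp_all add: MA_def MB_def P_def Q_def)
    have two: "(2 :: real) ^ n = 2 powr real n"
      by (simp add: powr_realpow)
    have "MA * (2 powr (- real n * (Hb r - \<delta>)) * (P * Q) / 2 ^ n)
      \<le> of_bool (0 < RA) * 2 powr (real n * RA) * (2 powr (- real n * (Hb r - \<delta>)) *
          (2 powr (real n * (Hb p + \<delta>)) * 2 powr (real n * (Hb q + \<delta>))) / 2 ^ n)"
      using pos by (intro mult_mono divide_right_mono M PQ mult_left_mono) auto
    also have "\<dots> = tA n"
      by (simp add: tA_def two powr_add[symmetric] powr_diff[symmetric] algebra_simps)
    finally have 1: "MA * (2 powr (- real n * (Hb r - \<delta>)) * (P * Q) / 2 ^ n) \<le> tA n" .
    have "MB * (Q / 2 ^ n) \<le> of_bool (0 < RB) * 2 powr (real n * RB) * (2 powr (real n * (Hb q + \<delta>)) / 2 ^ n)"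
      using pos by (intro mult_mono divide_right_mono M PQ) auto
    also have "\<dots> = of_bool (0 < RB) * 2 powr (real n * (RB + \<delta> - (1 - Hb q)))"
      by (simp add: two powr_add[symmetric] powr_diff[symmetric] algebra_simps)
    also have "\<dots> \<le> tB n"
      unfolding tB_def using \<delta> by (intro mult_left_mono powr_mono) auto
    finally have 2: "MB * (Q / 2 ^ n) \<le> tB n" .
    have "MA * (MB * (P * Q / 2 ^ n / 2 ^ n)) \<le> of_bool (0 < RA) * 2 powr (real n * RA) *
        (of_bool (0 < RB) * 2 powr (real n * RB) *
         (2 powr (real n * (Hb p + \<delta>)) * 2 powr (real n * (Hb q + \<delta>)) / 2 ^ n / 2 ^ n))"
      using pos by (intro mult_mono divide_right_mono M PQ) auto
    also have "\<dots> = of_bool (0 < RA \<and> 0 < RB) * 2 powr (real n * (RA + RB + 2 * \<delta> - (2 - Hb p - Hb q)))"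
      by (simp add: two powr_add[symmetric] powr_diff[symmetric] of_bool_conj algebra_simps)
    also have "\<dots> \<le> tAB n"
      unfolding tAB_def using \<delta> by (intro mult_left_mono powr_mono) auto
    finally have 3: "MA * (MB * (P * Q / 2 ^ n / 2 ^ n)) \<le> tAB n" .
    show ?thesis
      unfolding random_coding_bound_def[OF p q] \<alpha>_def r_def[symmetric]
        MA_def[symmetric] MB_def[symmetric] P_def[symmetric] Q_def[symmetric]
      using 1 2 3 by linarith
  qed
  then show ?thesis
    using nonneg by (intro tendsto_sandwich[OF _ _ tendsto_const lim0]) simp_all
qed

lemma joint_achievable_strict:
  fixes p13 p14 p23 p34 RA RB :: real
  defines "q \<equiv> bsc_compose (bsc_compose p13 p23) p34"
  assumes p: "0 \<le> p14" "p14 \<le> 1" and q: "0 \<le> q" "q \<le> 1" and R: "0 \<le> RA" "0 \<le> RB"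
    and A: "0 < RA \<Longrightarrow> RA < bsc_cap p14 + bsc_cap q - bsc_cap (bsc_compose p14 q)"
    and B: "0 < RB \<Longrightarrow> RB < bsc_cap q"
    and AB: "0 < RA \<Longrightarrow> 0 < RB \<Longrightarrow> RA + RB < bsc_cap p14 + bsc_cap q"
  shows "joint_achievable p13 p14 p23 p34 (RA, RB)"
proof -
  \<comment> \<open>A quarter of the gap leaves room for three \<delta>; if the premise fails, any
    positive \<delta> serves. The minimum of the three choices fits all inequalities.\<close>
  have slack: "\<exists>\<delta>>0. P \<longrightarrow> x + 3 * \<delta> < y" if "P \<Longrightarrow> x < y" for P and x y :: real
  proof (cases P)
    case True
    with that have "0 < (y - x) / 4" "x + 3 * ((y - x) / 4) < y"
      by (auto simp: field_simps)
    then show ?thesis by blast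
  qed (auto intro: zero_less_one)
  obtain \<delta>A \<delta>B \<delta>AB where \<delta>0: "0 < \<delta>A" "0 < \<delta>B" "0 < \<delta>AB"
    and A0: "0 < RA \<longrightarrow> RA + 3 * \<delta>A < bsc_cap p14 + bsc_cap q - bsc_cap (bsc_compose p14 q)"
    and B0: "0 < RB \<longrightarrow> RB + 3 * \<delta>B < bsc_cap q"
    and AB0: "0 < RA \<and> 0 < RB \<longrightarrow> RA + RB + 3 * \<delta>AB < bsc_cap p14 + bsc_cap q"
    using slack[of "0 < RA", OF A] slack[of "0 < RB", OF B] slack[of "0 < RA \<and> 0 < RB", OF AB] by blast
  define \<delta> where "\<delta> = min \<delta>A (min \<delta>B \<delta>AB)"
  have \<delta>: "0 < \<delta>" "\<delta> \<le> \<delta>A" "\<delta> \<le> \<delta>B" "\<delta> \<le> \<delta>AB"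
    using \<delta>0 by (auto simp: \<delta>_def)
  have lim: "(\<lambda>n. random_coding_bound p14 q \<delta> n (num_msgs n RA) (num_msgs n RB)) \<longlonglongrightarrow> 0"
    by (rule tendsto_random_coding_bound[OF p q \<delta>(1) R])
      (use A0 B0 AB0 \<delta> in \<open>auto simp: bsc_cap_def\<close>)
  have code: "\<exists>f g d. (\<forall>a\<in>{1..num_msgs n RA}. length (f a) = n) \<and> (\<forall>b\<in>{1..num_msgs n RB}. length (g b) = n) \<and>
      joint_err p13 p14 p23 p34 n (num_msgs n RA) (num_msgs n RB) f g d
      \<le> random_coding_bound p14 q \<delta> n (num_msgs n RA) (num_msgs n RB)" for n
  proof -
    define MA MB where "MA = num_msgs n RA" and "MB = num_msgs n RB"
    have M: "0 < MA" "0 < MB"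
      by (simp_all add: MA_def MB_def num_msgs_pos R)
    obtain f g where fg: "\<And>a. a \<in> {1..MA} \<Longrightarrow> f a \<in> words n" "\<And>b. b \<in> {1..MB} \<Longrightarrow> g b \<in> words n"
      and le: "(\<Sum>a\<in>{1..MA}. \<Sum>b\<in>{1..MB}. noise_mean p14 q n (\<lambda>e e'.
         of_bool (typical_decoder p14 q \<delta> n MA MB f g (bxor (f a) e) (bxor (f a) (bxor (g b) e')) \<noteq> (a, b))))
         \<le> real MA * real MB * random_coding_bound p14 q \<delta> n MA MB"
      using exists_good_code[OF p q M, of n \<delta>] by blast
    have "joint_err p13 p14 p23 p34 n MA MB f g (typical_decoder p14 q \<delta> n MA MB f g)
        \<le> random_coding_bound p14 q \<delta> n MA MB"
      using le M unfolding joint_err_eq q_def[symmetric] noise_mean_def[OF p q]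
      by (simp add: field_simps)
    then show ?thesis
      using fg unfolding MA_def MB_def words_def by blast
  qed
  show ?thesis
    unfolding joint_achievable_def fst_conv snd_conv
  proof (intro conjI R allI impI)
    fix \<epsilon> :: real assume "0 < \<epsilon>"
    then have "\<forall>\<^sub>F n in sequentially. random_coding_bound p14 q \<delta> n (num_msgs n RA) (num_msgs n RB) < \<epsilon>"
      by (rule order_tendstoD(2)[OF lim])
    then obtain N where N: "\<And>n. n \<ge> N \<Longrightarrow> random_coding_bound p14 q \<delta> n (num_msgs n RA) (num_msgs n RB) < \<epsilon>"
      unfolding eventually_sequentially by blast
    show "\<exists>N. \<forall>n\<ge>N. \<exists>f g d. (\<forall>a\<in>{1..num_msgs n RA}. length (f a) = n) \<and>
        (\<forall>b\<in>{1..num_msgs n RB}. length (g b) = n) \<and>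
        joint_err p13 p14 p23 p34 n (num_msgs n RA) (num_msgs n RB) f g d \<le> \<epsilon>"
    proof (intro exI[of _ N] allI impI)
      fix n assume "N \<le> n"
      then have small: "random_coding_bound p14 q \<delta> n (num_msgs n RA) (num_msgs n RB) \<le> \<epsilon>"
        by (rule less_imp_le[OF N])
      obtain f g d where "\<forall>a\<in>{1..num_msgs n RA}. length (f a) = n" "\<forall>b\<in>{1..num_msgs n RB}. length (g b) = n"
        "joint_err p13 p14 p23 p34 n (num_msgs n RA) (num_msgs n RB) f g d
          \<le> random_coding_bound p14 q \<delta> n (num_msgs n RA) (num_msgs n RB)"
        using code[of n] by blast
      with small show "\<exists>f g d. (\<forall>a\<in>{1..num_msgs n RA}. length (f a) = n) \<and>
        (\<forall>b\<in>{1..num_msgs n RB}. length (g b) = n) \<and>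
        joint_err p13 p14 p23 p34 n (num_msgs n RA) (num_msgs n RB) f g d \<le> \<epsilon>"
        by (intro exI[of _ f] exI[of _ g] exI[of _ d] conjI) auto
    qed
  qed
qed

section \<open>The capacity region\<close>

lemma joint_region_polyhedron:
  defines "c \<equiv> \<lambda>p q. bsc_cap p + bsc_cap q - bsc_cap (bsc_compose p q)"
  shows "joint_region p q = {x. 0 \<le> fst x} \<inter> {x. 0 \<le> snd x} \<inter> {x. fst x \<le> c p q} \<inter>
    {x. snd x \<le> bsc_cap q} \<inter> {x. fst x + snd x \<le> bsc_cap p + bsc_cap q}"
  by (auto simp: joint_region_def c_def)

lemma closed_joint_region: "closed (joint_region p q)"
  unfolding joint_region_polyhedron
  by (intro closed_Int closed_Collect_le continuous_intros)

lemma convex_joint_region: "convex (joint_region p q)"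
proof (rule convexI)
  fix x y and u v :: real
  assume x: "x \<in> joint_region p q" and y: "y \<in> joint_region p q" and uv: "0 \<le> u" "0 \<le> v" "u + v = 1"
  have le: "u * s + v * t \<le> c" if "s \<le> c" "t \<le> c" for s t c
    using convex_bound_le[OF that uv] .
  show "u *\<^sub>R x + v *\<^sub>R y \<in> joint_region p q"
    using x y uv
      le[of "fst x" "bsc_cap p + bsc_cap q - bsc_cap (bsc_compose p q)" "fst y"] le[of "snd x" _ "snd y"] le[of "fst x + snd x" _ "fst y + snd y"]
    by (auto simp: joint_region_polyhedron algebra_simps)
qed

text \<open>Scaling by \<open>t k\<close> keeps zero rates zero and lowers positive ones strictly.
  Approximation by points satisfying every inequality strictly can be impossible: for q = 1/2,
  \<open>bsc_cap q\<close> is 0 and the region lies on the axis where \<open>RB\<close> is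
  0.\<close>

lemma joint_region_subset_closure:
  fixes p13 p14 p23 p34 :: real
  defines "q \<equiv> bsc_compose (bsc_compose p13 p23) p34"
  assumes p: "0 \<le> p14" "p14 \<le> 1" and q: "0 \<le> q" "q \<le> 1"
  shows "joint_region p14 q \<subseteq> closure {R. joint_achievable p13 p14 p23 p34 R}"
proof
  fix R assume R: "R \<in> joint_region p14 q"
  obtain RA RB where [simp]: "R = (RA, RB)" by (cases R)
  define t where "t k = 1 - 1 / real (Suc k)" for k
  have t: "0 \<le> t k" "t k < 1" for k
    by (auto simp: t_def field_simps)
  have strict: "t k * x < y" if "0 < t k * x" "x \<le> y" for k x y
  proof -
    have "0 < x"
      using that(1) t(1)[of k] by (auto simp: zero_less_mult_iff)
    then have "t k * x < 1 * x"
      using t by (intro mult_strict_right_mono)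
    with that(2) show ?thesis by simp
  qed
  have "joint_achievable p13 p14 p23 p34 (t k *\<^sub>R R)" for k
  proof -
    have "joint_achievable p13 p14 p23 p34 (t k * RA, t k * RB)"
      using R p q t(1)[of k] strict[of k RA] strict[of k RB] strict[of k "RA + RB"] unfolding q_def
      by (intro joint_achievable_strict) (auto simp: joint_region_def distrib_left)
    then show ?thesis by simp
  qed
  moreover have "(\<lambda>k. t k *\<^sub>R R) \<longlonglongrightarrow> (1 - 0) *\<^sub>R R"
    unfolding t_def by (intro tendsto_intros LIMSEQ_Suc[OF lim_const_over_n])
  then have "(\<lambda>k. t k *\<^sub>R R) \<longlonglongrightarrow> R"
    by simp
  ultimately show "R \<in> closure {R. joint_achievable p13 p14 p23 p34 R}"
    unfolding closure_sequential by (intro exI[of _ "\<lambda>k. t k *\<^sub>R R"]) auto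
qed

theorem theorem3:
  fixes p13 p14 p23 p34 :: real
  assumes "0 \<le> p13" "p13 \<le> 1" "0 \<le> p14" "p14 \<le> 1"
      and "0 \<le> p23" "p23 \<le> 1" "0 \<le> p34" "p34 \<le> 1"
  defines "p' \<equiv> ((1 - p13) * (1 - p23) + p13 * p23) * p34
               + (p13 * (1 - p23) + (1 - p13) * p23) * (1 - p34)"
      and "p'' \<equiv> p13 * (1 - p23) * (1 - p34) * (1 - p14)
               + (1 - p13) * p23 * (1 - p34) * (1 - p14)
               + (1 - p13) * (1 - p23) * p34 * (1 - p14)
               + (1 - p13) * (1 - p23) * (1 - p34) * p14
               + (1 - p13) * p23 * p34 * p14
               + p13 * (1 - p23) * p34 * p14
               + p13 * p23 * (1 - p34) * p14
               + p13 * p23 * p34 * (1 - p14)"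
  shows "Lambda_joint p13 p14 p23 p34 =
         convex hull {(RA, RB). 0 \<le> RA \<and> 0 \<le> RB \<and>
            RA \<le> bsc_cap p14 + bsc_cap p' - bsc_cap p'' \<and>
            RB \<le> bsc_cap p' \<and>
            RA + RB \<le> bsc_cap p14 + bsc_cap p'}"
proof -
  define q where "q = bsc_compose (bsc_compose p13 p23) p34"
  \<comment> \<open>A cascade flips a bit exactly when an odd number of its channels do.
    \<open>p'\<close> is the probability of this for the three links leading to \<open>y34\<close>,
    and the eight products in \<open>p''\<close> are the odd flip patterns of all four
    links.\<close>
  have p': "p' = q"
    unfolding p'_def q_def bsc_compose_def by algebra
  have p'': "p'' = bsc_compose p14 q"
    unfolding p''_def q_def bsc_compose_def by algebra
  have q: "0 \<le> q" "q \<le> 1"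
    unfolding q_def using assms(1-8) by (simp_all add: bsc_compose_bounds)
  have "{R. joint_achievable p13 p14 p23 p34 R} \<subseteq> joint_region p14 q"
    using joint_achievable_in_region[of p14 p13 p23 p34] assms(3,4) q unfolding q_def by auto
  then have "Lambda_joint p13 p14 p23 p34 = joint_region p14 q"
    unfolding Lambda_joint_def
    using joint_region_subset_closure[of p14 p13 p23 p34] assms(3,4) q closed_joint_region
    unfolding q_def by (intro subset_antisym closure_minimal)
  also have "\<dots> = convex hull joint_region p14 q"
    by (simp add: hull_same convex_joint_region)
  finally show ?thesis
    unfolding p' p'' joint_region_def .
qed

end
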